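(* a) The maximal operator $$\widetilde S^{*}f:=\sup_{n\in\mathbb N_+}\frac{|S_nf|}{\log(n+1)}$$ is bounded from the Hardy space $H_1$ to the space $L_1$. b) Let $q_n=M_{2n}+M_{2n-2}+\dots+M_0$ and let $\{\Phi_n:n\in\mathbb N\}$ be any non-decreasing sequence of positive numbers satisfying $$\limsup_{n\to\infty}\frac{\log n}{\Phi_n}=+\infty .$$ Then there exists a sequence $\{n_k:k\in\mathbb N\}$ of positive integers such that, with $f_k:=D_{M_{2n_k+1}}-D_{M_{2n_k}}$, $$\sup_{k\in\mathbb N}\frac{\left\|\dfrac{S_{q_{n_k}}f_k}{\Phi_{q_{n_k}+1}}\right\|_{1}}{\|f_k\|_{H_1}}=\infty .$$
   Context: $\mathbb N_+$ is the set of positive integers, $\mathbb N=\mathbb N_+\cup\{0\}$. Fix a bounded sequence $m=(m_0,m_1,\dots)$ of integers $m_k\ge 2$. $G_m=\prod_{k\ge0}Z_{m_k}$, where $Z_{m_k}=\{0,\dots,m_k-1\}$ is the additive group modulo $m_k$, with the product of the discrete topologies; $\mu$ is the Haar measure with $\mu(G_m)=1$. $M_0:=1$, $M_{k+1}:=m_kM_k$; every $n\in\mathbb N$ is uniquely $n=\sum_{j\ge0}n_jM_j$ with $n_j\in Z_{m_j}$. $r_k(x):=\exp(2\pi i x_k/m_k)$, $\psi_n:=\prod_{k\ge0}r_k^{n_k}$ (Vilenkin system), $D_n:=\sum_{k=0}^{n-1}\psi_k$. $I_0(x):=G_m$, $I_n(x):=\{y: y_0=x_0,\dots,y_{n-1}=x_{n-1}\}$;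 $\mathcal F_n$ is the $\sigma$-algebra generated by $\{I_n(x):x\in G_m\}$. For $g\in L_1(G_m)$: $\widehat g(k):=\int g\overline{\psi_k}\,d\mu$, $S_ng:=\sum_{k=0}^{n-1}\widehat g(k)\psi_k$. A martingale is a sequence $f=(f^{(n)}:n\in\mathbb N)$ of integrable functions with $f^{(n)}$ $\mathcal F_n$-measurable and $S_{M_n}f^{(k)}=f^{(n)}$ for $n\le k$; $f^*:=\sup_n|f^{(n)}|$; $H_p$ is the set of martingales with $\|f\|_{H_p}:=\|f^*\|_p<\infty$, where $\|g\|_p:=(\int|g|^pd\mu)^{1/p}$. For a martingale, $\widehat f(i):=\lim_k\int f^{(k)}\overline{\psi_i}\,d\mu$ and $S_nf:=\sum_{k=0}^{n-1}\widehat f(k)\psi_k$. A function $g\in L_1$ is identified with the martingale $(S_{M_n}g:n\in\mathbb N)$, so $\|g\|_{H_1}=\|\sup_n|S_{M_n}g|\|_1$. An operator $T$ is bounded from $H_1$ to $L_1$ if there is a constant $C$ with $\|Tf\|_1\le C\|f\|_{H_1}$ for all $f\in H_1$. *)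

theory Defs
  imports "HOL-Probability.Probability"
begin

text \<open>
  The Vilenkin group \<open>G\<^sub>m\<close> is the set of all \<open>x\<close> with \<open>x k < m k\<close> for all \<open>k\<close>, under
  coordinatewise addition modulo \<open>m k\<close>. Functions on it are taken as complex-valued functions
  on \<open>nat \<Rightarrow> nat\<close>, whose values outside \<open>G\<^sub>m\<close> are irrelevant.
\<close>

definition vil_group :: "(nat \<Rightarrow> nat) \<Rightarrow> (nat \<Rightarrow> nat) set" where
  "vil_group m = {x. \<forall>k. x k < m k}"

definition vil_add :: "(nat \<Rightarrow> nat) \<Rightarrow> (nat \<Rightarrow> nat) \<Rightarrow> (nat \<Rightarrow> nat) \<Rightarrow> nat \<Rightarrow> nat" where
  "vil_add m a x = (\<lambda>k. (a k + x k) mod m k)"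

definition vil_topology :: "(nat \<Rightarrow> nat) \<Rightarrow> (nat \<Rightarrow> nat) topology" where
  "vil_topology m = product_topology (\<lambda>k. discrete_topology {..<m k}) UNIV"

text \<open>
  The normalized Haar measure is the product of the uniform probability measures on the
  coordinates. Lemmas \<open>vil_measure_sets\<close>, \<open>vil_measure_prob\<close> and \<open>vil_measure_invariant\<close>
  below show that it is the translation invariant probability measure on the Borel sets of
  \<open>vil_topology\<close>.
\<close>

definition vil_measure :: "(nat \<Rightarrow> nat) \<Rightarrow> (nat \<Rightarrow> nat) measure" where
  "vil_measure m = PiM UNIV (\<lambda>k. uniform_count_measure {..<m k})"

definition vil_M :: "(nat \<Rightarrow> nat) \<Rightarrow> nat \<Rightarrow> nat" where
  "vil_M m k = (\<Prod>j<k. m j)"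

text \<open>
  The \<open>j\<close>-th digit of \<open>n\<close> in the mixed radix expansion with bases \<open>m\<close>;
  see \<open>vil_digit_expansion\<close> and \<open>vil_digit_unique\<close>.
\<close>

definition vil_digit :: "(nat \<Rightarrow> nat) \<Rightarrow> nat \<Rightarrow> nat \<Rightarrow> nat" where
  "vil_digit m n j = (n div vil_M m j) mod m j"

definition vil_r :: "(nat \<Rightarrow> nat) \<Rightarrow> nat \<Rightarrow> (nat \<Rightarrow> nat) \<Rightarrow> complex" where
  "vil_r m k x = exp (2 * of_real pi * \<i> * of_nat (x k) / of_nat (m k))"

text \<open>
  The infinite product has only finitely many factors different from 1 and is taken over the
  indices of the nonzero digits.
\<close>

definition vil_psi :: "(nat \<Rightarrow> nat) \<Rightarrow> nat \<Rightarrow> (nat \<Rightarrow> nat) \<Rightarrow> complex" where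
  "vil_psi m n x = (\<Prod>k | vil_digit m n k \<noteq> 0. vil_r m k x ^ vil_digit m n k)"

definition vil_D :: "(nat \<Rightarrow> nat) \<Rightarrow> nat \<Rightarrow> (nat \<Rightarrow> nat) \<Rightarrow> complex" where
  "vil_D m n x = (\<Sum>k<n. vil_psi m k x)"

definition vil_I :: "(nat \<Rightarrow> nat) \<Rightarrow> nat \<Rightarrow> (nat \<Rightarrow> nat) \<Rightarrow> (nat \<Rightarrow> nat) set" where
  "vil_I m n x = {y \<in> vil_group m. \<forall>k<n. y k = x k}"

definition vil_F :: "(nat \<Rightarrow> nat) \<Rightarrow> nat \<Rightarrow> (nat \<Rightarrow> nat) measure" where
  "vil_F m n = sigma (vil_group m) (vil_I m n ` vil_group m)"

definition vil_coeff :: "(nat \<Rightarrow> nat) \<Rightarrow> ((nat \<Rightarrow> nat) \<Rightarrow> complex) \<Rightarrow> nat \<Rightarrow> complex" where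
  "vil_coeff m g k = (LINT x|vil_measure m. g x * cnj (vil_psi m k x))"

definition vil_S :: "(nat \<Rightarrow> nat) \<Rightarrow> nat \<Rightarrow> ((nat \<Rightarrow> nat) \<Rightarrow> complex) \<Rightarrow> (nat \<Rightarrow> nat) \<Rightarrow> complex" where
  "vil_S m n g x = (\<Sum>k<n. vil_coeff m g k * vil_psi m k x)"

text \<open>
  The last condition is required at every point of \<open>G\<^sub>m\<close>: both sides are constant on the
  cylinders \<open>vil_I m n x\<close>, which have positive measure.
\<close>

definition vil_martingale :: "(nat \<Rightarrow> nat) \<Rightarrow> (nat \<Rightarrow> (nat \<Rightarrow> nat) \<Rightarrow> complex) \<Rightarrow> bool" where
  "vil_martingale m f \<longleftrightarrow>
     (\<forall>n. integrable (vil_measure m) (f n)) \<and>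
     (\<forall>n. f n \<in> borel_measurable (vil_F m n)) \<and>
     (\<forall>n k. n \<le> k \<longrightarrow> (\<forall>x\<in>vil_group m. vil_S m (vil_M m n) (f k) x = f n x))"

text \<open>Maximal functions and norms may be infinite, hence take values in \<open>ennreal\<close>.\<close>

definition vil_max :: "(nat \<Rightarrow> (nat \<Rightarrow> nat) \<Rightarrow> complex) \<Rightarrow> (nat \<Rightarrow> nat) \<Rightarrow> ennreal" where
  "vil_max f x = (SUP n. ennreal (norm (f n x)))"

definition vil_L1_norm :: "(nat \<Rightarrow> nat) \<Rightarrow> ((nat \<Rightarrow> nat) \<Rightarrow> ennreal) \<Rightarrow> ennreal" where
  "vil_L1_norm m h = (\<integral>\<^sup>+ x. h x \<partial>vil_measure m)"

definition vil_H1_norm :: "(nat \<Rightarrow> nat) \<Rightarrow> (nat \<Rightarrow> (nat \<Rightarrow> nat) \<Rightarrow> complex) \<Rightarrow> ennreal" where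
  "vil_H1_norm m f = vil_L1_norm m (vil_max f)"

definition vil_H1 :: "(nat \<Rightarrow> nat) \<Rightarrow> (nat \<Rightarrow> (nat \<Rightarrow> nat) \<Rightarrow> complex) set" where
  "vil_H1 m = {f. vil_martingale m f \<and> vil_H1_norm m f < \<infinity>}"

definition vil_mart_coeff :: "(nat \<Rightarrow> nat) \<Rightarrow> (nat \<Rightarrow> (nat \<Rightarrow> nat) \<Rightarrow> complex) \<Rightarrow> nat \<Rightarrow> complex" where
  "vil_mart_coeff m f i = lim (\<lambda>k. LINT x|vil_measure m. f k x * cnj (vil_psi m i x))"

definition vil_mart_S ::
    "(nat \<Rightarrow> nat) \<Rightarrow> nat \<Rightarrow> (nat \<Rightarrow> (nat \<Rightarrow> nat) \<Rightarrow> complex) \<Rightarrow> (nat \<Rightarrow> nat) \<Rightarrow> complex" where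
  "vil_mart_S m n f x = (\<Sum>k<n. vil_mart_coeff m f k * vil_psi m k x)"

text \<open>The martingale with which an integrable function is identified.\<close>

definition vil_mart_of :: "(nat \<Rightarrow> nat) \<Rightarrow> ((nat \<Rightarrow> nat) \<Rightarrow> complex) \<Rightarrow> nat \<Rightarrow> (nat \<Rightarrow> nat) \<Rightarrow> complex" where
  "vil_mart_of m g n = vil_S m (vil_M m n) g"

definition vil_S_max :: "(nat \<Rightarrow> nat) \<Rightarrow> (nat \<Rightarrow> (nat \<Rightarrow> nat) \<Rightarrow> complex) \<Rightarrow> (nat \<Rightarrow> nat) \<Rightarrow> ennreal" where
  "vil_S_max m f x = (SUP n\<in>{1..}. ennreal (norm (vil_mart_S m n f x) / ln (real (n + 1))))"

definition bounded_H1_L1 ::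
    "(nat \<Rightarrow> nat) \<Rightarrow> ((nat \<Rightarrow> (nat \<Rightarrow> nat) \<Rightarrow> complex) \<Rightarrow> (nat \<Rightarrow> nat) \<Rightarrow> ennreal) \<Rightarrow> bool" where
  "bounded_H1_L1 m T \<longleftrightarrow>
     (\<exists>C::real. C \<ge> 0 \<and> (\<forall>f\<in>vil_H1 m. vil_L1_norm m (T f) \<le> ennreal C * vil_H1_norm m f))"

definition vil_q :: "(nat \<Rightarrow> nat) \<Rightarrow> nat \<Rightarrow> nat" where
  "vil_q m n = (\<Sum>j\<le>n. vil_M m (2 * j))"

definition vil_fk :: "(nat \<Rightarrow> nat) \<Rightarrow> nat \<Rightarrow> (nat \<Rightarrow> nat) \<Rightarrow> complex" where
  "vil_fk m n x = vil_D m (vil_M m (2 * n + 1)) x - vil_D m (vil_M m (2 * n)) x"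


subsection \<open>The measure is the normalized Haar measure\<close>

lemma space_vil_measure: "space (vil_measure m) = vil_group m"
  by (auto simp: vil_measure_def vil_group_def space_PiM space_uniform_count_measure PiE_def Pi_def)

lemma topspace_vil_topology: "topspace (vil_topology m) = vil_group m"
  by (auto simp: vil_topology_def vil_group_def PiE_def Pi_def)

lemma vil_measure_prob:
  assumes "\<And>k. m k \<ge> 2"
  shows "prob_space (vil_measure m)"
  unfolding vil_measure_def
proof (intro prob_space_PiM prob_space_uniform_count_measure)
  fix k show "{..<m k} \<noteq> {}" using assms[of k] by (auto simp: lessThan_empty_iff)
qed auto

lemma vil_I_sets: "vil_I m n x \<in> sets (vil_measure m)"
proof -
  have c: "{y \<in> space (vil_measure m). y k = x k} \<in> sets (vil_measure m)" for k
  proof -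
    have "{y \<in> space (vil_measure m). y k \<in> {x k} \<inter> {..<m k}} \<in> sets (vil_measure m)"
      unfolding vil_measure_def
      by (intro sets_Collect_single) (auto simp: sets_uniform_count_measure)
    moreover have "{y \<in> space (vil_measure m). y k \<in> {x k} \<inter> {..<m k}} =
        {y \<in> space (vil_measure m). y k = x k}"
      by (auto simp: space_vil_measure vil_group_def)
    ultimately show ?thesis by simp
  qed
  have "vil_I m n x = {y \<in> space (vil_measure m). \<forall>k\<in>{..<n}. y k = x k}"
    by (auto simp: vil_I_def space_vil_measure)
  also have "\<dots> \<in> sets (vil_measure m)"
    by (intro sets.sets_Collect_finite_All) (use c in auto)
  finally show ?thesis .
qed

lemma countable_vil_I: "countable {vil_I m n x | n x. x \<in> vil_group m}"
proof -
  have "{vil_I m n x | n x. x \<in> vil_group m} \<subseteq>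
      (\<lambda>(n, xs). {y \<in> vil_group m. \<forall>k<n. y k = xs ! k}) ` (UNIV :: (nat \<times> nat list) set)"
  proof clarify
    fix n x assume "x \<in> vil_group m"
    have "vil_I m n x = {y \<in> vil_group m. \<forall>k<n. y k = map x [0..<n] ! k}"
      by (auto simp: vil_I_def)
    then show "vil_I m n x \<in> (\<lambda>(n, xs). {y \<in> vil_group m. \<forall>k<n. y k = xs ! k}) ` UNIV"
      by (intro image_eqI[where x = "(n, map x [0..<n])"]) auto
  qed
  then show ?thesis by (rule countable_subset) auto
qed

lemma openin_vil_I:
  assumes U: "openin (vil_topology m) U" and x: "x \<in> U"
  shows "\<exists>n. vil_I m n x \<subseteq> U"
proof -
  obtain V where fin: "finite {i. V i \<noteq> {..<m i}}" and xV: "x \<in> Pi\<^sub>E UNIV V"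
    and VU: "Pi\<^sub>E UNIV V \<subseteq> U"
    using U x unfolding vil_topology_def openin_product_topology_alt by auto
  obtain n where n: "\<And>i. V i \<noteq> {..<m i} \<Longrightarrow> i < n"
    using fin by (meson finite_nat_set_iff_bounded mem_Collect_eq)
  have "vil_I m n x \<subseteq> Pi\<^sub>E UNIV V"
  proof
    fix y assume y: "y \<in> vil_I m n x"
    have "y i \<in> V i" for i
    proof (cases "i < n")
      case True then show ?thesis using y xV by (auto simp: vil_I_def PiE_def Pi_def)
    next
      case False
      then have "V i = {..<m i}" using n by blast
      then show ?thesis using y by (auto simp: vil_I_def vil_group_def)
    qed
    then show "y \<in> Pi\<^sub>E UNIV V" by auto
  qed
  then show ?thesis using VU by blast
qed

lemma vil_measure_sets:
  "sets (vil_measure m) = sigma_sets (vil_group m) {U. openin (vil_topology m) U}"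
proof
  have opens: "U \<subseteq> vil_group m" if "openin (vil_topology m) U" for U
    using openin_subset[OF that] by (simp add: topspace_vil_topology)
  show "sigma_sets (vil_group m) {U. openin (vil_topology m) U} \<subseteq> sets (vil_measure m)"
  proof (subst space_vil_measure[symmetric], rule sets.sigma_sets_subset, safe)
    fix U assume U: "openin (vil_topology m) U"
    let ?C = "{A \<in> {vil_I m n x | n x. x \<in> vil_group m}. A \<subseteq> U}"
    have "U = \<Union>?C"
    proof (intro equalityI subsetI)
      fix x assume "x \<in> U"
      then obtain n where "vil_I m n x \<subseteq> U" using openin_vil_I[OF U] by blast
      moreover have "x \<in> vil_group m" using opens[OF U] \<open>x \<in> U\<close> by blast
      moreover from this have "x \<in> vil_I m n x" by (simp add: vil_I_def)
      ultimately show "x \<in> \<Union>?C" by blast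
    qed blast
    moreover have "countable ?C"
      by (rule countable_subset[OF _ countable_vil_I]) auto
    then have "\<Union>?C \<in> sets (vil_measure m)"
      by (rule sets.countable_Union) (auto simp: vil_I_sets)
    ultimately show "U \<in> sets (vil_measure m)" by simp
  qed
  show "sets (vil_measure m) \<subseteq> sigma_sets (vil_group m) {U. openin (vil_topology m) U}"
  proof -
    let ?N = "sigma (vil_group m) {U. openin (vil_topology m) U}"
    have sp: "space ?N = vil_group m" and st:
      "sets ?N = sigma_sets (vil_group m) {U. openin (vil_topology m) U}"
      using opens by (auto simp: space_measure_of_conv intro!: sets_measure_of)
    have G: "vil_group m = (\<Pi>\<^sub>E i\<in>UNIV. space (uniform_count_measure {..<m i}))"
      by (auto simp: vil_group_def space_uniform_count_measure PiE_def Pi_def)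
    have "sets (vil_measure m) = sigma_sets (vil_group m)
        {{f \<in> vil_group m. f i \<in> A} | i A. i \<in> UNIV \<and> A \<in> sets (uniform_count_measure {..<m i})}"
      unfolding vil_measure_def sets_PiM_single G ..
    also have "\<dots> \<subseteq> sigma_sets (vil_group m) {U. openin (vil_topology m) U}"
    proof (rule sigma_sets_mono', safe)
      fix i A assume "A \<in> sets (uniform_count_measure {..<m i})"
      then have A: "A \<subseteq> {..<m i}" by (simp add: sets_uniform_count_measure)
      have "openin (vil_topology m) {f \<in> topspace (vil_topology m). f i \<in> A}"
        unfolding vil_topology_def
        by (rule openin_continuous_map_preimage[OF continuous_map_product_projection])
           (use A in auto)
      then show "openin (vil_topology m) {f \<in> vil_group m. f i \<in> A}"
        by (simp add: topspace_vil_topology)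
    qed
    finally show ?thesis .
  qed
qed

lemma vil_measure_invariant:
  assumes m: "\<And>k. m k \<ge> 2" and a: "a \<in> vil_group m"
  shows "distr (vil_measure m) (vil_measure m) (vil_add m a) = vil_measure m"
proof -
  let ?u = "\<lambda>k. uniform_count_measure {..<m k}"
  have mpos: "m k > 0" for k using m[of k] by simp
  then have ne: "{..<m k} \<noteq> {}" for k by (metis lessThan_iff empty_iff)
  interpret product_prob_space ?u UNIV
    by (intro product_prob_spaceI prob_space_uniform_count_measure) (use ne in auto)
  have meas: "vil_add m a \<in> measurable (PiM UNIV ?u) (PiM UNIV ?u)"
    unfolding vil_add_def
  proof (rule measurable_PiM_single')
    fix i
    have "(\<lambda>y. (a i + y) mod m i) \<in> measurable (?u i) (?u i)"
      using mpos[of i] by (auto simp: measurable_def space_uniform_count_measure sets_uniform_count_measure)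
    from measurable_compose[OF measurable_component_singleton[of i UNIV ?u] this]
    show "(\<lambda>x. (a i + x i) mod m i) \<in> measurable (PiM UNIV ?u) (?u i)" by simp
  next
    show "(\<lambda>x i. (a i + x i) mod m i) \<in>
        space (PiM UNIV ?u) \<rightarrow> (\<Pi>\<^sub>E i\<in>UNIV. space (?u i))"
      using mpos by (auto simp: space_PiM space_uniform_count_measure)
  qed
  have "distr (PiM UNIV ?u) (PiM UNIV ?u) (vil_add m a) = PiM UNIV ?u"
  proof (rule PiM_eq)
    fix J F assume J: "finite J" "J \<subseteq> UNIV" and F: "\<And>j. j \<in> J \<Longrightarrow> F j \<in> sets (?u j)"
    have Fs: "F j \<subseteq> {..<m j}" if "j \<in> J" for j
      using F[OF that] by (simp add: sets_uniform_count_measure)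
    let ?F' = "\<lambda>j. {y \<in> {..<m j}. (a j + y) mod m j \<in> F j}"
    have card: "card (?F' j) = card (F j)" if j: "j \<in> J" for j
    proof -
      have aj: "a j < m j" using a by (simp add: vil_group_def)
      have "bij_betw (\<lambda>y. (a j + y) mod m j) (?F' j) (F j)"
      proof (rule bij_betw_byWitness[where f' = "\<lambda>z. (z + (m j - a j)) mod m j"])
        show "\<forall>y\<in>?F' j. ((a j + y) mod m j + (m j - a j)) mod m j = y"
        proof
          fix y assume y: "y \<in> ?F' j"
          have "((a j + y) mod m j + (m j - a j)) mod m j = (a j + y + (m j - a j)) mod m j"
            by (simp add: mod_add_left_eq)
          also have "a j + y + (m j - a j) = y + m j" using aj by simp
          finally show "((a j + y) mod m j + (m j - a j)) mod m j = y" using y by simp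
        qed
        have inv1: "(a j + (z + (m j - a j)) mod m j) mod m j = z" if "z \<in> F j" for z
        proof -
          have "(a j + (z + (m j - a j)) mod m j) mod m j = (a j + (z + (m j - a j))) mod m j"
            by (simp add: mod_add_right_eq)
          also have "a j + (z + (m j - a j)) = z + m j" using aj by simp
          finally show ?thesis using Fs[OF j] that by auto
        qed
        then show "\<forall>z\<in>F j. (a j + (z + (m j - a j)) mod m j) mod m j = z" by blast
        show "(\<lambda>y. (a j + y) mod m j) ` ?F' j \<subseteq> F j" by auto
        show "(\<lambda>z. (z + (m j - a j)) mod m j) ` F j \<subseteq> ?F' j"
          using inv1 aj by auto
      qed
      then show ?thesis by (rule bij_betw_same_card)
    qed
    have pre: "vil_add m a -` prod_emb UNIV ?u J (Pi\<^sub>E J F) \<inter> space (PiM UNIV ?u) =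
        prod_emb UNIV ?u J (Pi\<^sub>E J ?F')"
      using mpos by (auto simp: prod_emb_def space_PiM space_uniform_count_measure vil_add_def
          PiE_def Pi_def extensional_def restrict_def)
    have "emeasure (distr (PiM UNIV ?u) (PiM UNIV ?u) (vil_add m a)) (prod_emb UNIV ?u J (Pi\<^sub>E J F))
        = emeasure (PiM UNIV ?u) (prod_emb UNIV ?u J (Pi\<^sub>E J ?F'))"
      using meas J F by (subst emeasure_distr) (auto simp: pre intro!: sets_PiM_I)
    also have "\<dots> = (\<Prod>j\<in>J. emeasure (?u j) (?F' j))"
      using J by (intro emeasure_PiM_emb) (auto simp: sets_uniform_count_measure)
    also have "\<dots> = (\<Prod>j\<in>J. emeasure (?u j) (F j))"
    proof (rule prod.cong)
      fix j assume j: "j \<in> J"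
      have "emeasure (?u j) (?F' j) = ennreal (card (?F' j) / card {..<m j})"
        by (rule emeasure_uniform_count_measure) auto
      also have "\<dots> = ennreal (card (F j) / card {..<m j})" by (simp only: card[OF j])
      also have "\<dots> = emeasure (?u j) (F j)"
        by (rule emeasure_uniform_count_measure[symmetric]) (use Fs[OF j] in auto)
      finally show "emeasure (?u j) (?F' j) = emeasure (?u j) (F j)" .
    qed simp
    finally show "emeasure (distr (PiM UNIV ?u) (PiM UNIV ?u) (vil_add m a))
        (prod_emb UNIV ?u J (Pi\<^sub>E J F)) = (\<Prod>j\<in>J. emeasure (?u j) (F j))" .
  qed simp
  then show ?thesis by (simp add: vil_measure_def)
qed


subsection \<open>The digits give the mixed radix expansion\<close>

lemma vil_M_0 [simp]: "vil_M m 0 = 1"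
  by (simp add: vil_M_def)

lemma vil_M_Suc [simp]: "vil_M m (Suc k) = m k * vil_M m k"
  by (simp add: vil_M_def mult.commute)

lemma vil_digit_mod: "(\<Sum>j<K. vil_digit m n j * vil_M m j) = n mod vil_M m K"
proof (induction K)
  case (Suc K)
  have "n mod vil_M m (Suc K) = n mod (vil_M m K * m K)" by (simp add: mult.commute)
  also have "\<dots> = vil_M m K * (n div vil_M m K mod m K) + n mod vil_M m K"
    by (rule mod_mult2_eq)
  finally show ?case using Suc by (simp add: vil_digit_def mult.commute)
qed simp

lemma vil_M_gt:
  assumes "\<And>k. m k \<ge> 2"
  shows "k < vil_M m k"
proof (induction k)
  case (Suc k)
  have "2 * vil_M m k \<le> m k * vil_M m k" using assms[of k] by (rule mult_right_mono) simp
  moreover have "Suc k < 2 * vil_M m k" using Suc by simp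
  ultimately show ?case by (simp only: vil_M_Suc)
qed simp

lemma vil_digit_expansion:
  assumes "\<And>k. m k \<ge> 2"
  shows "vil_digit m n j < m j" "finite {j. vil_digit m n j \<noteq> 0}"
    "n = (\<Sum>j | vil_digit m n j \<noteq> 0. vil_digit m n j * vil_M m j)"
proof -
  show "vil_digit m n j < m j" using assms[of j] by (simp add: vil_digit_def)
  have small: "j < n" if "vil_digit m n j \<noteq> 0" for j
  proof (rule ccontr)
    assume "\<not> j < n"
    then have "n < vil_M m j" using vil_M_gt[of m j, OF assms] by simp
    then show False using that by (simp add: vil_digit_def)
  qed
  have "{j. vil_digit m n j \<noteq> 0} \<subseteq> {..<n}" using small by blast
  then show "finite {j. vil_digit m n j \<noteq> 0}" by (rule finite_subset) simp
  have "(\<Sum>j | vil_digit m n j \<noteq> 0. vil_digit m n j * vil_M m j) =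
      (\<Sum>j<n. vil_digit m n j * vil_M m j)"
    by (rule sum.mono_neutral_left) (use small in auto)
  also have "\<dots> = n" using vil_M_gt[of m n, OF assms] by (simp add: vil_digit_mod)
  finally show "n = (\<Sum>j | vil_digit m n j \<noteq> 0. vil_digit m n j * vil_M m j)" by simp
qed

lemma vil_digit_unique:
  assumes m: "\<And>k. m k \<ge> 2" and d: "\<And>j. d j < m j" and fin: "finite {j. d j \<noteq> 0}"
    and n: "n = (\<Sum>j | d j \<noteq> 0. d j * vil_M m j)"
  shows "d i = vil_digit m n i"
proof -
  have lt: "(\<Sum>j<i. d j * vil_M m j) < vil_M m i" for i
  proof (induction i)
    case (Suc i)
    have "(\<Sum>j<Suc i. d j * vil_M m j) < vil_M m i + d i * vil_M m i" using Suc by simp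
    also have "\<dots> = Suc (d i) * vil_M m i" by simp
    also have "\<dots> \<le> m i * vil_M m i" using d[of i] by (intro mult_right_mono) auto
    finally show ?case by simp
  qed simp
  obtain K where K: "\<And>j. d j \<noteq> 0 \<Longrightarrow> j < K"
    using fin by (meson finite_nat_set_iff_bounded mem_Collect_eq)
  define L where "L = K + Suc i"
  have nL: "n = (\<Sum>j<L. d j * vil_M m j)"
    unfolding n by (rule sum.mono_neutral_left) (use K in \<open>auto simp: L_def intro: trans_less_add1 less_SucI\<close>)
  have "\<exists>c. (\<Sum>j<Suc i + l. d j * vil_M m j) = (\<Sum>j<Suc i. d j * vil_M m j) + c * vil_M m (Suc i)"
    for l
  proof (induction l)
    case (Suc l)
    have "vil_M m (Suc i) dvd vil_M m (Suc i + l)"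
      unfolding vil_M_def by (rule prod_dvd_prod_subset) auto
    then obtain b where "vil_M m (Suc i + l) = vil_M m (Suc i) * b" by (rule dvdE)
    moreover obtain c where
      "(\<Sum>j<Suc i + l. d j * vil_M m j) = (\<Sum>j<Suc i. d j * vil_M m j) + c * vil_M m (Suc i)"
      using Suc by blast
    moreover have "(\<Sum>j<Suc i + Suc l. d j * vil_M m j) =
        (\<Sum>j<Suc i + l. d j * vil_M m j) + d (Suc i + l) * vil_M m (Suc i + l)" by simp
    ultimately have "(\<Sum>j<Suc i + Suc l. d j * vil_M m j) =
        (\<Sum>j<Suc i. d j * vil_M m j) + (c + d (Suc i + l) * b) * vil_M m (Suc i)"
      by (simp only: algebra_simps)
    then show ?case by blast
  next
    case 0
    show ?case by (rule exI[of _ 0]) simp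
  qed
  from this[of K] obtain c where
    "n = (\<Sum>j<Suc i. d j * vil_M m j) + c * vil_M m (Suc i)"
    using nL by (auto simp: L_def add.commute)
  then have n2: "n = (\<Sum>j<i. d j * vil_M m j) + vil_M m i * (d i + c * m i)"
    by (simp add: algebra_simps)
  have "n div vil_M m i = d i + c * m i"
    unfolding n2 using lt[of i] by (simp add: div_mult_self2)
  then show ?thesis using d[of i] by (simp add: vil_digit_def)
qed

end

theory Submission
  imports Defs
begin

text \<open>
  Put \<open>K\<^sub>n(x, t) = (\<Sum>k<n. \<psi>\<^sub>k(x) * cnj (\<psi>\<^sub>k(t)))\<close>. The kernel with index \<open>M\<^sub>j\<close> averages over
  the cylinders of level \<open>j\<close>; call this averaging \<open>E\<^sub>j\<close>. If \<open>m\<close> is bounded by \<open>B\<close> and \<open>M\<^sub>N \<le> n < M\<^bsub>N+1\<^esub>\<close>,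
  then \<open>\<bar>K\<^sub>n\<bar>\<close> is at most \<open>B\<close> times the sum over \<open>j \<le> N\<close> of the kernels with index \<open>M\<^sub>j\<close>, whence
  \<open>\<bar>S\<^sub>n f\<bar> / log (n + 1)\<close> is at most a constant times the mean of \<open>E\<^sub>j \<bar>f\<^bsub>N+1\<^esub>\<bar>\<close> over \<open>j \<le> N\<close>.

  No atomic decomposition is needed: \<open>\<bar>f\<^bsub>N+1\<^esub>\<bar>\<close> is dominated by the running maximum, that is by the sum
  of its increments \<open>\<Delta>\<^sub>k \<ge> 0\<close> with \<open>k \<le> N + 1\<close>. Since \<open>E\<^sub>j \<Delta>\<^sub>k = \<Delta>\<^sub>k\<close> for \<open>j \<ge> k\<close>, the mean is at most
  \<open>\<Sum>k. \<Delta>\<^sub>k + 1/k * (\<Sum>j<k. E\<^sub>j \<Delta>\<^sub>k)\<close>, which does not depend on \<open>N\<close> and has integral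
  at most \<open>2 * \<parallel>f\<^sup>*\<parallel>\<^sub>1\<close>.

  For the second part, \<open>f = D\<^bsub>M(2n+1)\<^esub> - D\<^bsub>M(2n)\<^esub>\<close> has norm between 1 and 2 in \<open>H\<^sub>1\<close>, and with \<open>q = q\<^sub>n\<close> the
  modulus of \<open>S\<^sub>q f\<close> is that of the Dirichlet kernel of index \<open>q\<^bsub>n-1\<^esub>\<close>. The latter is at least \<open>2/3 * M\<^bsub>2j\<^esub>\<close>
  on \<open>I\<^bsub>2j\<^esub> - I\<^bsub>2j+1\<^esub>\<close> for every \<open>j < n\<close>, so its norm grows linearly in \<open>n\<close>, like \<open>log q\<^sub>n\<close>.
\<close>

subsection \<open>Characters and their kernels\<close>

lemma sum_lessThan_add:
  fixes f :: "nat \<Rightarrow> 'a::comm_monoid_add"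
  shows "(\<Sum>k<p + b. f k) = (\<Sum>k<p. f k) + (\<Sum>k<b. f (p + k))"
  by (induction b) (auto simp: add.assoc)

lemma vil_M_dvd: "j \<le> k \<Longrightarrow> vil_M m j dvd vil_M m k"
  unfolding vil_M_def by (rule prod_dvd_prod_subset) auto

lemma vil_digit_add_mult:
  assumes "j < N"
  shows "vil_digit m (c * vil_M m N + d) j = vil_digit m d j"
proof -
  obtain b where b: "vil_M m N = vil_M m (Suc j) * b"
    using vil_M_dvd[of "Suc j" N m] assms by (auto elim: dvdE)
  have eq: "c * vil_M m N + d = d + vil_M m j * (m j * (b * c))"
    unfolding b by (simp add: algebra_simps)
  show ?thesis
    \<comment> \<open>Nothing is known about \<open>m\<close> here, so \<open>vil_M m j\<close> may
      be zero; division by zero then gives 0 for both digits.\<close>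
    unfolding eq vil_digit_def by (cases "vil_M m j = 0") simp_all
qed

lemma vil_digit_eq_0: "n < vil_M m j \<Longrightarrow> vil_digit m n j = 0"
  by (simp add: vil_digit_def)

locale vilenkin =
  fixes m :: "nat \<Rightarrow> nat"
  assumes m_ge_2: "m k \<ge> 2"
begin

sublocale prob_space "vil_measure m"
  by (rule vil_measure_prob) (rule m_ge_2)

lemma m_pos [simp]: "0 < m k"
  using m_ge_2[of k] by simp

lemma m_ge_1 [simp]: "Suc 0 \<le> m k"
  using m_ge_2[of k] by simp

lemma vil_M_pos [simp]: "0 < vil_M m k"
  by (simp add: vil_M_def prod_pos)

lemma vil_M_strict_mono: "strict_mono (vil_M m)"
proof (rule strict_monoI_Suc)
  fix n
  have "1 * vil_M m n < m n * vil_M m n"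
    using m_ge_2[of n] by (intro mult_strict_right_mono) auto
  then show "vil_M m n < vil_M m (Suc n)" by simp
qed

lemma vil_M_mono: "j \<le> k \<Longrightarrow> vil_M m j \<le> vil_M m k"
  using vil_M_strict_mono by (simp add: strict_mono_less_eq)

lemma power_le_vil_M: "2 ^ k \<le> vil_M m k"
  by (induction k) (auto intro!: mult_mono m_ge_2)

section \<open>Multiplicativity of the characters\<close>

lemma vil_psi_eq_prod:
  assumes "n < vil_M m K"
  shows "vil_psi m n x = (\<Prod>k<K. vil_r m k x ^ vil_digit m n k)"
  unfolding vil_psi_def
proof (rule prod.mono_neutral_left)
  have "vil_digit m n k = 0" if "K \<le> k" for k
    using assms vil_M_mono[OF that] by (intro vil_digit_eq_0) simp
  then show "{k. vil_digit m n k \<noteq> 0} \<subseteq> {..<K}"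
    by (force simp: not_less[symmetric])
qed auto

text \<open>Since \<open>d < vil_M m N\<close>, the number \<open>c\<close> is the digit at place
  \<open>N\<close> and \<open>d\<close> carries the digits below it, so the digit product
  factors.\<close>

lemma vil_psi_split:
  assumes c: "c < m N" and d: "d < vil_M m N"
  shows "vil_psi m (c * vil_M m N + d) x = vil_r m N x ^ c * vil_psi m d x"
proof -
  have "c * vil_M m N + d < Suc c * vil_M m N"
    using d by simp
  also have "\<dots> \<le> m N * vil_M m N"
    using c by (intro mult_right_mono) auto
  finally have lt: "c * vil_M m N + d < vil_M m (Suc N)" by simp
  have "vil_digit m (c * vil_M m N + d) N = c"
    using c d by (simp add: vil_digit_def)
  then show ?thesis
    unfolding vil_psi_eq_prod[OF lt] vil_psi_eq_prod[OF d]
    by (simp add: vil_digit_add_mult mult.commute)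
qed

lemma vil_psi_0 [simp]: "vil_psi m 0 x = 1"
  by (simp add: vil_psi_def vil_digit_def)

lemma norm_vil_r [simp]: "norm (vil_r m k x) = 1"
proof -
  have "vil_r m k x = exp (\<i> * of_real (2 * pi * real (x k) / real (m k)))"
    by (simp add: vil_r_def mult_ac)
  then show ?thesis by (simp only: norm_exp_i_times)
qed

lemma norm_vil_psi [simp]: "norm (vil_psi m n x) = 1"
  by (simp add: vil_psi_def prod_norm[symmetric] norm_power)

lemma vil_psi_cnj: "vil_psi m n x * cnj (vil_psi m n x) = 1"
  by (simp add: complex_norm_square[symmetric])

text \<open>Coordinates of group elements lie below \<open>m k\<close>, where different residues
  give different roots of unity.\<close>

lemma vil_r_eq_iff:
  assumes "x \<in> vil_group m" "t \<in> vil_group m"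
  shows "vil_r m k x = vil_r m k t \<longleftrightarrow> x k = t k"
proof -
  have "vil_r m k x = vil_r m k t \<longleftrightarrow> x k mod m k = t k mod m k"
    unfolding vil_r_def by (intro complex_root_unity_eq) simp
  then show ?thesis using assms by (simp add: vil_group_def)
qed

lemma vil_r_power [simp]: "vil_r m k x ^ m k = 1"
proof -
  have "vil_r m k x ^ m k = exp (of_nat (m k) * (2 * of_real pi * \<i> * of_nat (x k) / of_nat (m k)))"
    unfolding vil_r_def by (rule exp_of_nat_mult[symmetric])
  also have "of_nat (m k) * (2 * of_real pi * \<i> * of_nat (x k) / of_nat (m k)) =
      of_real (2 * of_nat (x k) * pi) * \<i>"
    using m_pos[of k] by (simp del: m_pos)
  also have "exp \<dots> = 1"
    using exp_integer_2pi[of "of_nat (x k)"] by simp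
  finally show ?thesis .
qed

lemma vil_r_add: "vil_r m k (vil_add m a x) = vil_r m k a * vil_r m k x"
proof -
  let ?e = "\<lambda>n. exp (2 * of_real pi * \<i> * of_nat n / of_nat (m k)) :: complex"
  have "?e ((a k + x k) mod m k) = ?e (a k + x k)"
    by (subst complex_root_unity_eq) simp_all
  also have "\<dots> = ?e (a k) * ?e (x k)"
    by (simp add: exp_add[symmetric] ring_distribs add_divide_distrib)
  finally show ?thesis by (simp add: vil_r_def vil_add_def)
qed

lemma vil_psi_add: "vil_psi m n (vil_add m a x) = vil_psi m n a * vil_psi m n x"
  by (simp add: vil_psi_def vil_r_add power_mult_distrib prod.distrib)

lemma vil_psi_cong:
  assumes "n < vil_M m N" "\<And>i. i < N \<Longrightarrow> x i = y i"
  shows "vil_psi m n x = vil_psi m n y"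
  using assms(2) by (simp add: vil_psi_eq_prod[OF assms(1)] vil_r_def)

section \<open>Measurability and orthonormality of the characters\<close>

lemma measurable_coordinate [measurable]: "(\<lambda>x. x k) \<in> vil_measure m \<rightarrow>\<^sub>M count_space UNIV"
proof -
  have 1: "(\<lambda>x. x k) \<in> vil_measure m \<rightarrow>\<^sub>M uniform_count_measure {..<m k}"
    unfolding vil_measure_def by (rule measurable_component_singleton) simp
  have 2: "(\<lambda>n. n) \<in> uniform_count_measure {..<m k} \<rightarrow>\<^sub>M count_space UNIV"
    by (auto simp: measurable_def space_uniform_count_measure sets_uniform_count_measure)
  show ?thesis
    by (rule measurable_compose[OF 1 2])
qed

lemma measurable_vil_r [measurable]: "vil_r m k \<in> borel_measurable (vil_measure m)"
proof -
  have eq: "vil_r m k = (\<lambda>n. exp (2 * of_real pi * \<i> * of_nat n / of_nat (m k))) \<circ> (\<lambda>x. x k)"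
    by (rule ext) (simp only: vil_r_def o_def)
  show ?thesis
    unfolding eq by (rule measurable_comp[OF measurable_coordinate borel_measurable_count_space])
qed

lemma measurable_vil_psi [measurable]: "vil_psi m n \<in> borel_measurable (vil_measure m)"
proof -
  have eq: "vil_psi m n = (\<lambda>x. \<Prod>k | vil_digit m n k \<noteq> 0. vil_r m k x ^ vil_digit m n k)"
    by (rule ext) (simp only: vil_psi_def)
  show ?thesis
    unfolding eq by (rule borel_measurable_prod) (rule borel_measurable_power, rule measurable_vil_r)
qed

lemma measurable_cnj_vil_psi [measurable]:
  "(\<lambda>x. cnj (vil_psi m n x)) \<in> borel_measurable (vil_measure m)"
  by (rule measurable_compose[OF measurable_vil_psi])
    (intro borel_measurable_continuous_onI continuous_intros)

lemma integrable_vil_psi_cnj: "integrable (vil_measure m) (\<lambda>x. vil_psi m l x * cnj (vil_psi m i x))"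
proof (rule integrable_const_bound[where B = 1])
  show "AE x in vil_measure m. norm (vil_psi m l x * cnj (vil_psi m i x)) \<le> 1"
    by (intro AE_I2) (simp only: norm_mult complex_mod_cnj norm_vil_psi mult_1_left order_refl)
  show "(\<lambda>x. vil_psi m l x * cnj (vil_psi m i x)) \<in> borel_measurable (vil_measure m)"
    by measurable
qed

lemma measurable_vil_add:
  assumes "a \<in> vil_group m"
  shows "vil_add m a \<in> vil_measure m \<rightarrow>\<^sub>M vil_measure m"
proof -
  have *: "(\<lambda>x. (a i + x i) mod m i) \<in> vil_measure m \<rightarrow>\<^sub>M uniform_count_measure {..<m i}" for i
    by (rule measurable_compose[OF measurable_coordinate[of i]])
      (auto simp: space_uniform_count_measure)
  have eq: "vil_add m a = (\<lambda>x i. (a i + x i) mod m i)"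
    by (intro ext) (simp only: vil_add_def)
  have "vil_add m a \<in> vil_measure m \<rightarrow>\<^sub>M PiM UNIV (\<lambda>k. uniform_count_measure {..<m k})"
    unfolding eq
  proof (rule measurable_PiM_single'[OF *])
    show "(\<lambda>x i. (a i + x i) mod m i) \<in> space (vil_measure m) \<rightarrow>
        (\<Pi>\<^sub>E i\<in>UNIV. space (uniform_count_measure {..<m i}))"
      by (auto simp: space_uniform_count_measure)
  qed
  then show ?thesis by (simp only: vil_measure_def)
qed

text \<open>If the digits of \<open>l\<close> and \<open>i\<close> differ at place \<open>k\<close>,
  translate by the unit vector \<open>a\<close> at \<open>k\<close>. The invariant integral is
  multiplied by \<open>vil_psi m l a * cnj (vil_psi m i a)\<close>, which is not 1, so it
  vanishes.\<close>

lemma vil_psi_orthonormal: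
  "(LINT x|vil_measure m. vil_psi m l x * cnj (vil_psi m i x)) = (if l = i then 1 else 0)"
proof (cases "l = i")
  case True
  have "(LINT x|vil_measure m. vil_psi m i x * cnj (vil_psi m i x)) = (LINT x|vil_measure m. 1)"
    by (simp only: vil_psi_cnj)
  also have "\<dots> = 1" by (simp add: prob_space)
  finally show ?thesis by (simp only: True simp_thms if_True)
next
  case False
  let ?I = "LINT x|vil_measure m. vil_psi m l x * cnj (vil_psi m i x)"
  have "l = i" if "vil_digit m l = vil_digit m i"
    using vil_digit_expansion(3)[of m l, OF m_ge_2] vil_digit_expansion(3)[of m i, OF m_ge_2]
    unfolding that by (rule trans[OF _ sym])
  then obtain k where k: "vil_digit m l k \<noteq> vil_digit m i k"
    using False by blast
  define a :: "nat \<Rightarrow> nat" where "a = (\<lambda>j. if j = k then 1 else 0)"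
  have a: "a \<in> vil_group m"
    using m_ge_2[of k] by (auto simp: a_def vil_group_def)
  have psi_a: "vil_psi m n a = exp (2 * of_real pi * \<i> * of_nat (vil_digit m n k) / of_nat (m k))" for n
  proof -
    have "vil_psi m n a = (\<Prod>j\<in>{j. vil_digit m n j \<noteq> 0} \<inter> {k}. vil_r m j a ^ vil_digit m n j)"
      unfolding vil_psi_def
      by (rule prod.mono_neutral_right)
        (use vil_digit_expansion(2)[of m, OF m_ge_2] in \<open>auto simp: vil_r_def a_def\<close>)
    also have "\<dots> = vil_r m k a ^ vil_digit m n k"
      by (cases "vil_digit m n k = 0") auto
    also have "\<dots> = exp (of_nat (vil_digit m n k) * (2 * of_real pi * \<i> / of_nat (m k)))"
      by (simp add: vil_r_def a_def exp_of_nat_mult[symmetric])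
    finally show ?thesis by (simp add: mult_ac)
  qed
  have ne: "vil_psi m l a \<noteq> vil_psi m i a"
    unfolding psi_a using k m_pos[of k] vil_digit_expansion(1)[of m, OF m_ge_2]
    by (subst complex_root_unity_eq) auto
  have "?I = (LINT x|distr (vil_measure m) (vil_measure m) (vil_add m a).
      vil_psi m l x * cnj (vil_psi m i x))"
    by (simp add: vil_measure_invariant[OF m_ge_2 a])
  also have "\<dots> = (LINT x|vil_measure m. vil_psi m l (vil_add m a x) * cnj (vil_psi m i (vil_add m a x)))"
    by (rule integral_distr[OF measurable_vil_add[OF a]]) simp
  also have "\<dots> = (LINT x|vil_measure m. (vil_psi m l a * cnj (vil_psi m i a)) *
      (vil_psi m l x * cnj (vil_psi m i x)))"
    by (simp add: vil_psi_add mult_ac)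
  also have "\<dots> = vil_psi m l a * cnj (vil_psi m i a) * ?I"
    by (rule integral_mult_right_zero)
  finally have "(1 - vil_psi m l a * cnj (vil_psi m i a)) * ?I = 0"
    by (simp add: algebra_simps)
  moreover have "vil_psi m l a * cnj (vil_psi m i a) \<noteq> 1"
  proof
    assume *: "vil_psi m l a * cnj (vil_psi m i a) = 1"
    have "vil_psi m l a = vil_psi m l a * cnj (vil_psi m i a) * vil_psi m i a"
      using vil_psi_cnj[of i a] by (simp add: mult_ac)
    then show False using * ne by simp
  qed
  ultimately show ?thesis using False by simp
qed

lemma LINT_vil_psi: "(LINT x|vil_measure m. vil_psi m l x) = (if l = 0 then 1 else 0)"
  using vil_psi_orthonormal[of l 0] by simp

section \<open>Dirichlet kernels in two variables\<close>

text \<open>This is the Dirichlet kernel at the group difference of \<open>x\<close> and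
  \<open>t\<close>; keeping both variables avoids subtraction in the group.\<close>

definition vil_kernel :: "nat \<Rightarrow> (nat \<Rightarrow> nat) \<Rightarrow> (nat \<Rightarrow> nat) \<Rightarrow> complex" where
  "vil_kernel n x t = (\<Sum>k<n. vil_psi m k x * cnj (vil_psi m k t))"

lemma vil_kernel_split:
  assumes a: "a < m N" and b: "b \<le> vil_M m N"
  defines "\<rho> \<equiv> \<lambda>x t. vil_r m N x * cnj (vil_r m N t)"
  shows "vil_kernel (a * vil_M m N + b) x t =
    (\<Sum>c<a. \<rho> x t ^ c) * vil_kernel (vil_M m N) x t + \<rho> x t ^ a * vil_kernel b x t"
proof -
  have block: "(\<Sum>k<b. vil_psi m (c * vil_M m N + k) x * cnj (vil_psi m (c * vil_M m N + k) t)) =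
      \<rho> x t ^ c * vil_kernel b x t" if "c < m N" "b \<le> vil_M m N" for b c
    unfolding vil_kernel_def sum_distrib_left
    using that by (intro sum.cong) (auto simp: vil_psi_split \<rho>_def power_mult_distrib)
  have "vil_kernel (a * vil_M m N) x t = (\<Sum>c<a. \<rho> x t ^ c) * vil_kernel (vil_M m N) x t"
    if "a \<le> m N" for a
    using that
  proof (induction a)
    case (Suc a)
    have "vil_kernel (Suc a * vil_M m N) x t = vil_kernel (a * vil_M m N + vil_M m N) x t"
      by (simp add: add.commute)
    also have "\<dots> = vil_kernel (a * vil_M m N) x t + \<rho> x t ^ a * vil_kernel (vil_M m N) x t"
      using Suc.prems block[of a "vil_M m N"] by (simp add: vil_kernel_def sum_lessThan_add)
    finally show ?case using Suc by (simp add: algebra_simps)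
  qed (simp add: vil_kernel_def)
  moreover have "vil_kernel (a * vil_M m N + b) x t =
      vil_kernel (a * vil_M m N) x t + \<rho> x t ^ a * vil_kernel b x t"
    using a b block[of a b] by (simp add: vil_kernel_def sum_lessThan_add)
  ultimately show ?thesis using a by simp
qed

text \<open>Passing to the next level multiplies by the geometric sum of the first
  \<open>m N\<close> powers of an \<open>m N\<close>-th root of unity: it is \<open>m N\<close> if
  that root is 1 and zero otherwise.\<close>

lemma vil_kernel_M:
  assumes x: "x \<in> vil_group m" and t: "t \<in> vil_group m"
  shows "vil_kernel (vil_M m N) x t = (if \<forall>i<N. x i = t i then of_nat (vil_M m N) else 0)"
proof (induction N)
  case 0
  then show ?case by (simp add: vil_kernel_def)
next
  case (Suc N)
  define \<rho> where "\<rho> = vil_r m N x * cnj (vil_r m N t)"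
  have "vil_M m (Suc N) = (m N - 1) * vil_M m N + vil_M m N"
    using m_pos[of N] by (cases "m N") (auto simp del: m_pos)
  then have "vil_kernel (vil_M m (Suc N)) x t =
      ((\<Sum>c<m N - 1. \<rho> ^ c) + \<rho> ^ (m N - 1)) * vil_kernel (vil_M m N) x t"
    using m_pos[of N] by (simp only: vil_kernel_split[of "m N - 1" N "vil_M m N"] \<rho>_def)
      (simp add: algebra_simps)
  also have "(\<Sum>c<m N - 1. \<rho> ^ c) + \<rho> ^ (m N - 1) = (\<Sum>c<m N. \<rho> ^ c)"
    using m_pos[of N] by (cases "m N") (auto simp del: m_pos)
  also have "\<dots> = (if x N = t N then of_nat (m N) else 0)"
  proof (cases "x N = t N")
    case True
    then have "\<rho> = 1"
      unfolding \<rho>_def using x t by (simp add: vil_r_eq_iff[symmetric] complex_norm_square[symmetric])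
    then show ?thesis using True by simp
  next
    case False
    have "\<rho> * vil_r m N t = vil_r m N x"
      by (simp add: \<rho>_def mult.assoc mult.commute[of "cnj _"] complex_norm_square[symmetric])
    then have "\<rho> \<noteq> 1" using False x t by (auto simp: vil_r_eq_iff)
    moreover have "\<rho> ^ m N = 1"
      by (simp add: \<rho>_def power_mult_distrib flip: complex_cnj_power)
    ultimately show ?thesis using False by (simp add: geometric_sum)
  qed
  finally show ?case using Suc.IH by (auto simp: less_Suc_eq)
qed

text \<open>Splitting off the leading digit \<open>a < m N\<close> costs fewer than \<open>B\<close>
  copies of the kernel of level \<open>N\<close>; the remaining kernel has index below
  \<open>vil_M m N\<close> and a unimodular factor.\<close>

lemma norm_vil_kernel_le:
  assumes "n < vil_M m N" and B: "\<And>k. m k \<le> B"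
  shows "norm (vil_kernel n x t) \<le> real B * (\<Sum>j<N. norm (vil_kernel (vil_M m j) x t))"
  using assms(1)
proof (induction N arbitrary: n)
  case 0
  then show ?case by (simp add: vil_kernel_def)
next
  case (Suc N)
  let ?K = "\<lambda>n. vil_kernel n x t"
  define a where "a = n div vil_M m N"
  define b where "b = n mod vil_M m N"
  define \<rho> where "\<rho> = vil_r m N x * cnj (vil_r m N t)"
  have n: "n = a * vil_M m N + b" by (simp only: a_def b_def div_mult_mod_eq)
  have b: "b < vil_M m N" by (simp add: b_def)
  have a: "a < m N"
    using Suc.prems by (simp add: a_def less_mult_imp_div_less)
  have \<rho>: "norm \<rho> = 1" by (simp add: \<rho>_def norm_mult)
  have "norm (?K n) \<le> norm (\<Sum>c<a. \<rho> ^ c) * norm (?K (vil_M m N)) + norm (?K b)"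
    unfolding n vil_kernel_split[OF a less_imp_le[OF b]] \<rho>_def[symmetric]
    by (rule order_trans[OF norm_triangle_ineq]) (simp add: norm_mult norm_power \<rho>)
  also have "norm (\<Sum>c<a. \<rho> ^ c) \<le> real B"
  proof -
    have "norm (\<Sum>c<a. \<rho> ^ c) \<le> (\<Sum>c<a. 1)"
      by (rule sum_norm_le) (simp add: norm_power \<rho>)
    also have "\<dots> \<le> real B" using a B[of N] by simp
    finally show ?thesis .
  qed
  also note Suc.IH[OF b]
  finally show ?case
    by (simp add: distrib_left add.commute mult_right_mono)
qed

end

subsection \<open>The maximal operator\<close>

primrec run_max :: "(nat \<Rightarrow> real) \<Rightarrow> nat \<Rightarrow> real" where
  "run_max a 0 = a 0"
| "run_max a (Suc n) = max (run_max a n) (a (Suc n))"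

text \<open>Kept real-valued so that the differences telescope exactly; the passage to
  \<open>ennreal\<close> happens only in \<open>vil_inc\<close>.\<close>

primrec run_inc :: "(nat \<Rightarrow> real) \<Rightarrow> nat \<Rightarrow> real" where
  "run_inc a 0 = a 0"
| "run_inc a (Suc n) = run_max a (Suc n) - run_max a n"

lemma run_inc_nonneg: "a 0 \<ge> 0 \<Longrightarrow> run_inc a n \<ge> 0"
  by (cases n) auto

lemma sum_run_inc: "(\<Sum>k\<le>n. run_inc a k) = run_max a n"
  by (induction n) auto

lemma le_run_max: "a n \<le> run_max a n"
  by (cases n) auto

lemma run_max_cong: "(\<And>k. k \<le> n \<Longrightarrow> a k = b k) \<Longrightarrow> run_max a n = run_max b n"
  by (induction n) auto

lemma run_inc_cong: "(\<And>k. k \<le> n \<Longrightarrow> a k = b k) \<Longrightarrow> run_inc a n = run_inc b n"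
  by (cases n) (auto intro!: arg_cong2[of _ _ _ _ max] arg_cong2[of _ _ _ _ minus] run_max_cong
      simp del: run_max.simps simp: run_max_cong[of _ a b])

lemma measurable_run_max:
  assumes "\<And>k. (\<lambda>x. a x k) \<in> borel_measurable M"
  shows "(\<lambda>x. run_max (a x) n) \<in> borel_measurable M"
  by (induction n) (auto intro!: borel_measurable_max assms)

lemma measurable_run_inc:
  assumes "\<And>k. (\<lambda>x. a x k) \<in> borel_measurable M"
  shows "(\<lambda>x. run_inc (a x) n) \<in> borel_measurable M"
  by (cases n) (auto intro!: borel_measurable_diff measurable_run_max assms simp del: run_max.simps)

context vilenkin
begin

section \<open>Fourier coefficients and partial sums of martingales\<close>

lemma vil_coeff_sum:
  assumes "finite A"
  shows "vil_coeff m (\<lambda>x. \<Sum>l\<in>A. c l * vil_psi m l x) i = (if i \<in> A then c i else 0)"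
proof -
  have "vil_coeff m (\<lambda>x. \<Sum>l\<in>A. c l * vil_psi m l x) i =
      (LINT x|vil_measure m. (\<Sum>l\<in>A. c l * (vil_psi m l x * cnj (vil_psi m i x))))"
    unfolding vil_coeff_def by (simp only: sum_distrib_right mult.assoc)
  also have "\<dots> = (\<Sum>l\<in>A. LINT x|vil_measure m. c l * (vil_psi m l x * cnj (vil_psi m i x)))"
    by (intro Bochner_Integration.integral_sum integrable_mult_right integrable_vil_psi_cnj)
  also have "\<dots> = (\<Sum>l\<in>A. if l = i then c l else 0)"
    by (intro sum.cong) (auto simp: vil_psi_orthonormal)
  also have "\<dots> = (if i \<in> A then c i else 0)"
    using assms by (simp add: sum.delta')
  finally show ?thesis .
qed

lemma integrable_mult_cnj_vil_psi:
  assumes "integrable (vil_measure m) g"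
  shows "integrable (vil_measure m) (\<lambda>x. g x * cnj (vil_psi m k x))"
proof (rule Bochner_Integration.integrable_bound[OF assms])
  show "(\<lambda>x. g x * cnj (vil_psi m k x)) \<in> borel_measurable (vil_measure m)"
    using assms by (intro borel_measurable_times measurable_cnj_vil_psi) (rule borel_measurable_integrable)
qed (simp add: norm_mult)

lemma
  assumes "integrable (vil_measure m) g"
  shows integrable_mult_vil_kernel: "integrable (vil_measure m) (\<lambda>t. g t * vil_kernel n x t)"
    and vil_S_eq_kernel: "vil_S m n g x = (LINT t|vil_measure m. g t * vil_kernel n x t)"
proof -
  have eq: "g t * vil_kernel n x t = (\<Sum>k<n. g t * cnj (vil_psi m k t) * vil_psi m k x)" for t
    by (simp add: vil_kernel_def sum_distrib_left mult_ac)
  show "integrable (vil_measure m) (\<lambda>t. g t * vil_kernel n x t)"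
    unfolding eq
    by (intro Bochner_Integration.integrable_sum integrable_mult_left integrable_mult_cnj_vil_psi assms)
  show "vil_S m n g x = (LINT t|vil_measure m. g t * vil_kernel n x t)"
    unfolding eq vil_S_def vil_coeff_def
    by (subst Bochner_Integration.integral_sum)
      (simp_all add: integrable_mult_cnj_vil_psi[OF assms])
qed

text \<open>The partial sum of index \<open>vil_M m N\<close> maps every later \<open>f k\<close> to
  \<open>f N\<close> and keeps the coefficients below that index. The sequence in the limit is
  therefore constant from \<open>N\<close> on.\<close>

lemma vil_mart_coeff_eq:
  assumes f: "vil_martingale m f" and i: "i < vil_M m N"
  shows "vil_mart_coeff m f i = vil_coeff m (f N) i"
proof -
  have "vil_coeff m (f k) i = vil_coeff m (f N) i" if "N \<le> k" for k
  proof -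
    have "vil_S m (vil_M m N) (f k) x = f N x" if "x \<in> vil_group m" for x
      using f \<open>N \<le> k\<close> that by (auto simp: vil_martingale_def)
    then have "vil_coeff m (f N) i = vil_coeff m (vil_S m (vil_M m N) (f k)) i"
      unfolding vil_coeff_def
      by (intro Bochner_Integration.integral_cong) (auto simp: space_vil_measure)
    also have "\<dots> = vil_coeff m (f k) i"
      using i vil_coeff_sum[of "{..<vil_M m N}" "vil_coeff m (f k)" i]
      by (simp add: vil_S_def[abs_def])
    finally show ?thesis ..
  qed
  then have "eventually (\<lambda>k. vil_coeff m (f k) i = vil_coeff m (f N) i) sequentially"
    by (rule eventually_sequentiallyI)
  then have "(\<lambda>k. vil_coeff m (f k) i) \<longlonglongrightarrow> vil_coeff m (f N) i"
    by (rule tendsto_eventually)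
  then show ?thesis
    unfolding vil_mart_coeff_def vil_coeff_def[of m "f _", symmetric] by (rule limI)
qed

lemma vil_mart_S_eq:
  assumes "vil_martingale m f" "n \<le> vil_M m N"
  shows "vil_mart_S m n f x = vil_S m n (f N) x"
  unfolding vil_mart_S_def vil_S_def
  using assms by (intro sum.cong) (auto simp: vil_mart_coeff_eq)

text \<open>\<open>f N\<close> is its own partial sum of index \<open>vil_M m N\<close>, a
  combination of characters that read only the first \<open>N\<close> coordinates.\<close>

lemma vil_martingale_cong:
  assumes f: "vil_martingale m f" and x: "x \<in> vil_group m" and y: "y \<in> vil_group m"
    and eq: "\<And>i. i < N \<Longrightarrow> x i = y i"
  shows "f N x = f N y"
proof -
  have "f N z = vil_S m (vil_M m N) (f N) z" if "z \<in> vil_group m" for z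
    using f that by (auto simp: vil_martingale_def)
  moreover have "vil_S m (vil_M m N) (f N) x = vil_S m (vil_M m N) (f N) y"
    unfolding vil_S_def using vil_psi_cong[of _ N x y] eq by (intro sum.cong) auto
  ultimately show ?thesis using x y by simp
qed

section \<open>Averages over cylinders\<close>

lemma vil_kernel_cnj: "vil_kernel n x t = cnj (vil_kernel n t x)"
  by (simp add: vil_kernel_def mult.commute)

lemma norm_vil_kernel_commute: "norm (vil_kernel n x t) = norm (vil_kernel n t x)"
  by (subst vil_kernel_cnj) (rule complex_mod_cnj)

lemma measurable_norm_vil_kernel:
  "(\<lambda>p. ennreal (norm (vil_kernel n (fst p) (snd p))))
    \<in> borel_measurable (vil_measure m \<Otimes>\<^sub>M vil_measure m)"
proof -
  have "(\<lambda>p. vil_psi m k (fst p) * cnj (vil_psi m k (snd p)))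
      \<in> borel_measurable (vil_measure m \<Otimes>\<^sub>M vil_measure m)" for k
    by (rule borel_measurable_times)
      (rule measurable_compose[OF measurable_fst measurable_vil_psi],
       rule measurable_compose[OF measurable_snd measurable_cnj_vil_psi])
  then have [measurable]: "(\<lambda>p. vil_kernel n (fst p) (snd p)) \<in> borel_measurable (vil_measure m \<Otimes>\<^sub>M vil_measure m)"
    unfolding vil_kernel_def by (rule borel_measurable_sum)
  show ?thesis by measurable
qed

lemma measurable_norm_vil_kernel':
  assumes "x \<in> vil_group m"
  shows "(\<lambda>t. ennreal (norm (vil_kernel n x t))) \<in> borel_measurable (vil_measure m)"
proof -
  have "(\<lambda>t. (x, t)) \<in> vil_measure m \<rightarrow>\<^sub>M vil_measure m \<Otimes>\<^sub>M vil_measure m"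
    using assms by (intro measurable_Pair1') (simp add: space_vil_measure)
  from measurable_compose[OF this measurable_norm_vil_kernel] show ?thesis by simp
qed

lemma LINT_vil_kernel: "n > 0 \<Longrightarrow> (LINT t|vil_measure m. vil_kernel n t x) = 1"
proof -
  assume n: "n > 0"
  have "integrable (vil_measure m) (\<lambda>t. vil_psi m k t)" for k
    using integrable_vil_psi_cnj[of k 0] by simp
  then have "(LINT t|vil_measure m. vil_kernel n t x) =
      (\<Sum>k<n. (LINT t|vil_measure m. vil_psi m k t) * cnj (vil_psi m k x))"
    unfolding vil_kernel_def by (subst Bochner_Integration.integral_sum) auto
  also have "\<dots> = (\<Sum>k<n. if k = 0 then 1 else 0)"
    by (intro sum.cong) (auto simp: LINT_vil_psi)
  also have "\<dots> = 1" using n by (simp add: sum.delta)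
  finally show ?thesis .
qed

lemma nn_integral_norm_vil_kernel_M:
  assumes x: "x \<in> vil_group m"
  shows "(\<integral>\<^sup>+t. ennreal (norm (vil_kernel (vil_M m N) t x)) \<partial>vil_measure m) = 1"
proof -
  let ?K = "\<lambda>t. vil_kernel (vil_M m N) t x"
  have K: "integrable (vil_measure m) ?K"
    unfolding vil_kernel_cnj[of _ _ x]
    using integrable_mult_vil_kernel[of "\<lambda>_. 1" "vil_M m N" x] by simp
  have "complex_of_real (LINT t|vil_measure m. norm (?K t)) = (LINT t|vil_measure m. of_real (norm (?K t)))"
    by simp
  also have "\<dots> = (LINT t|vil_measure m. ?K t)"
    using x by (intro Bochner_Integration.integral_cong) (auto simp: vil_kernel_M space_vil_measure)
  also have "\<dots> = 1" by (rule LINT_vil_kernel) simp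
  finally have "(LINT t|vil_measure m. norm (?K t)) = 1"
    by (simp only: of_real_eq_1_iff)
  then show ?thesis
    using nn_integral_eq_integral[OF integrable_norm[OF K]] by simp
qed

text \<open>The conditional expectation onto the cylinders of level \<open>N\<close>, written
  through the kernel so that \<open>norm_vil_kernel_le\<close> applies directly, and in
  \<open>ennreal\<close> so that no integrability is asked for.\<close>

definition vil_avg :: "nat \<Rightarrow> ((nat \<Rightarrow> nat) \<Rightarrow> ennreal) \<Rightarrow> (nat \<Rightarrow> nat) \<Rightarrow> ennreal" where
  "vil_avg N h x = (\<integral>\<^sup>+t. h t * ennreal (norm (vil_kernel (vil_M m N) x t)) \<partial>vil_measure m)"

lemma measurable_vil_avg:
  assumes h: "h \<in> borel_measurable (vil_measure m)"
  shows "vil_avg N h \<in> borel_measurable (vil_measure m)"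
proof -
  have "(\<lambda>p. h (snd p) * ennreal (norm (vil_kernel (vil_M m N) (fst p) (snd p))))
      \<in> borel_measurable (vil_measure m \<Otimes>\<^sub>M vil_measure m)"
    by (rule borel_measurable_times_ennreal[OF measurable_compose[OF measurable_snd h]
          measurable_norm_vil_kernel])
  then have "(\<lambda>x. \<integral>\<^sup>+t. h t * ennreal (norm (vil_kernel (vil_M m N) x t)) \<partial>vil_measure m)
      \<in> borel_measurable (vil_measure m)"
    by (intro borel_measurable_nn_integral) (simp add: case_prod_beta')
  moreover have "vil_avg N h = (\<lambda>x. \<integral>\<^sup>+t. h t * ennreal (norm (vil_kernel (vil_M m N) x t)) \<partial>vil_measure m)"
    by (rule ext) (simp only: vil_avg_def)
  ultimately show ?thesis by (simp only:)
qed

text \<open>Tonelli: the kernel has mass one in its other variable as well.\<close>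

lemma nn_integral_vil_avg:
  assumes h: "h \<in> borel_measurable (vil_measure m)"
  shows "(\<integral>\<^sup>+x. vil_avg N h x \<partial>vil_measure m) = (\<integral>\<^sup>+x. h x \<partial>vil_measure m)"
proof -
  interpret P: pair_sigma_finite "vil_measure m" "vil_measure m" ..
  have meas: "(\<lambda>(t, x). h t * ennreal (norm (vil_kernel (vil_M m N) x t)))
      \<in> borel_measurable (vil_measure m \<Otimes>\<^sub>M vil_measure m)"
    unfolding case_prod_beta' norm_vil_kernel_commute[of _ "snd _"]
    by (rule borel_measurable_times_ennreal[OF measurable_compose[OF measurable_fst h]
          measurable_norm_vil_kernel])
  have "(\<integral>\<^sup>+x. vil_avg N h x \<partial>vil_measure m) =
      (\<integral>\<^sup>+t. (\<integral>\<^sup>+x. h t * ennreal (norm (vil_kernel (vil_M m N) x t)) \<partial>vil_measure m) \<partial>vil_measure m)"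
    unfolding vil_avg_def by (rule P.Fubini'[OF meas])
  also have "\<dots> = (\<integral>\<^sup>+t. h t \<partial>vil_measure m)"
  proof (rule nn_integral_cong)
    fix t assume "t \<in> space (vil_measure m)"
    then have t: "t \<in> vil_group m" by (simp add: space_vil_measure)
    have "(\<lambda>x. ennreal (norm (vil_kernel (vil_M m N) x t))) \<in> borel_measurable (vil_measure m)"
      unfolding norm_vil_kernel_commute[of _ _ t] by (rule measurable_norm_vil_kernel'[OF t])
    then show "(\<integral>\<^sup>+x. h t * ennreal (norm (vil_kernel (vil_M m N) x t)) \<partial>vil_measure m) = h t"
      by (simp add: nn_integral_cmult nn_integral_norm_vil_kernel_M[OF t])
  qed
  finally show ?thesis .
qed

lemma vil_avg_eq:
  assumes x: "x \<in> vil_group m"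
    and h: "\<And>t. t \<in> vil_group m \<Longrightarrow> (\<And>i. i < N \<Longrightarrow> x i = t i) \<Longrightarrow> h t = h x"
  shows "vil_avg N h x = h x"
proof -
  have "vil_avg N h x = (\<integral>\<^sup>+t. h x * ennreal (norm (vil_kernel (vil_M m N) x t)) \<partial>vil_measure m)"
    unfolding vil_avg_def
  proof (rule nn_integral_cong)
    fix t assume "t \<in> space (vil_measure m)"
    then have t: "t \<in> vil_group m" by (simp add: space_vil_measure)
    show "h t * ennreal (norm (vil_kernel (vil_M m N) x t)) =
        h x * ennreal (norm (vil_kernel (vil_M m N) x t))"
    proof (cases "\<forall>i<N. x i = t i")
      case True
      then have "h t = h x" by (intro h[OF t]) simp
      then show ?thesis by (simp only:)
    next
      case False
      then show ?thesis by (simp only: vil_kernel_M[OF x t] if_False) simp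
    qed
  qed
  also have "\<dots> = h x * (\<integral>\<^sup>+t. ennreal (norm (vil_kernel (vil_M m N) x t)) \<partial>vil_measure m)"
    by (rule nn_integral_cmult[OF measurable_norm_vil_kernel'[OF x]])
  also have "\<dots> = h x"
    unfolding norm_vil_kernel_commute[of _ x] nn_integral_norm_vil_kernel_M[OF x] by simp
  finally show ?thesis .
qed

section \<open>Increments of the running maximum and their majorants\<close>

lemma measurable_vil_martingale:
  "vil_martingale m f \<Longrightarrow> f n \<in> borel_measurable (vil_measure m)"
  unfolding vil_martingale_def by (intro borel_measurable_integrable) blast

text \<open>The increments are nonnegative because the sequence of norms starts nonnegative, so
  \<open>ennreal\<close> truncates nothing.\<close>

definition vil_inc :: "(nat \<Rightarrow> (nat \<Rightarrow> nat) \<Rightarrow> complex) \<Rightarrow> nat \<Rightarrow> (nat \<Rightarrow> nat) \<Rightarrow> ennreal" where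
  "vil_inc f k x = ennreal (run_inc (\<lambda>j. norm (f j x)) k)"

lemma measurable_vil_inc:
  assumes "vil_martingale m f"
  shows "vil_inc f k \<in> borel_measurable (vil_measure m)"
proof -
  note [measurable] = measurable_vil_martingale[OF assms]
  have "(\<lambda>x. norm (f j x)) \<in> borel_measurable (vil_measure m)" for j
    by measurable
  then have "(\<lambda>x. run_inc (\<lambda>j. norm (f j x)) k) \<in> borel_measurable (vil_measure m)"
    by (rule measurable_run_inc)
  from measurable_compose[OF this measurable_ennreal] show ?thesis
    by (simp add: vil_inc_def[abs_def])
qed

lemma sum_vil_inc: "(\<Sum>k\<le>n. vil_inc f k x) = ennreal (run_max (\<lambda>j. norm (f j x)) n)"
  unfolding vil_inc_def by (simp add: sum_ennreal run_inc_nonneg sum_run_inc)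

lemma norm_le_sum_vil_inc: "ennreal (norm (f n x)) \<le> (\<Sum>k\<le>n. vil_inc f k x)"
  unfolding sum_vil_inc by (intro ennreal_leI) (rule le_run_max)

text \<open>Partial sums telescope to running maxima, and each running maximum is one of the values
  \<open>norm (f j x)\<close>.\<close>

lemma suminf_vil_inc_le: "(\<Sum>k. vil_inc f k x) \<le> vil_max f x"
proof (rule suminf_le_const[OF summableI])
  fix n
  have run_max_in: "\<exists>k. run_max a n = a k" for a :: "nat \<Rightarrow> real" and n
    by (induction n) (auto simp: max_def)
  have "(\<Sum>k<n. vil_inc f k x) \<le> (\<Sum>k\<le>n. vil_inc f k x)"
    by (intro sum_mono2) auto
  also have "\<dots> \<le> vil_max f x"
    unfolding sum_vil_inc vil_max_def
    using run_max_in[of "\<lambda>j. norm (f j x)" n] by (auto intro: SUP_upper2)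
  finally show "(\<Sum>k<n. vil_inc f k x) \<le> vil_max f x" .
qed

text \<open>The increments are adapted: they involve only \<open>f j\<close> with
  \<open>j \<le> k\<close>, all constant on cylinders of level \<open>k\<close>. This makes
  \<open>vil_avg_eq\<close> applicable to them.\<close>

lemma vil_inc_cong:
  assumes "vil_martingale m f" "x \<in> vil_group m" "y \<in> vil_group m" "\<And>i. i < k \<Longrightarrow> x i = y i"
  shows "vil_inc f k x = vil_inc f k y"
  unfolding vil_inc_def
  by (intro arg_cong[of _ _ ennreal] run_inc_cong arg_cong[of _ _ norm]
      vil_martingale_cong[OF assms(1-3)]) (rule assms(4), simp)

text \<open>
  Majorizes the mean over \<open>j \<le> N\<close> of the averages \<open>vil_avg j (vil_inc f k)\<close> for all
  \<open>N + 1 \<ge> k\<close> at once: the terms with \<open>j \<ge> k\<close> leave the increment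
  unchanged, and in the terms with \<open>j < k\<close> the factor \<open>1 / (N + 1)\<close> is at most \<open>1 / k\<close>.
  For \<open>k = 0\<close> the second summand is an empty sum.
\<close>

definition vil_dom :: "(nat \<Rightarrow> (nat \<Rightarrow> nat) \<Rightarrow> complex) \<Rightarrow> nat \<Rightarrow> (nat \<Rightarrow> nat) \<Rightarrow> ennreal" where
  "vil_dom f k x = vil_inc f k x + ennreal (1 / real k) * (\<Sum>j<k. vil_avg j (vil_inc f k) x)"

lemma measurable_vil_dom:
  assumes "vil_martingale m f"
  shows "vil_dom f k \<in> borel_measurable (vil_measure m)"
proof -
  have "(\<lambda>x. vil_inc f k x + ennreal (1 / real k) * (\<Sum>j<k. vil_avg j (vil_inc f k) x))
      \<in> borel_measurable (vil_measure m)"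
    by (intro borel_measurable_add borel_measurable_times_ennreal borel_measurable_const
        borel_measurable_sum measurable_vil_avg measurable_vil_inc assms)
  then show ?thesis by (simp add: vil_dom_def[abs_def])
qed

text \<open>Averaging preserves integrals, so \<open>k\<close> averages with weight
  \<open>1 / k\<close> cost at most one more copy of the integral.\<close>

lemma nn_integral_vil_dom_le:
  assumes f: "vil_martingale m f"
  shows "(\<integral>\<^sup>+x. vil_dom f k x \<partial>vil_measure m) \<le> 2 * (\<integral>\<^sup>+x. vil_inc f k x \<partial>vil_measure m)"
proof -
  let ?I = "\<integral>\<^sup>+x. vil_inc f k x \<partial>vil_measure m"
  note meas = measurable_vil_inc[OF f, of k] measurable_vil_avg[OF measurable_vil_inc[OF f], of _ k]
  have "(\<integral>\<^sup>+x. vil_dom f k x \<partial>vil_measure m) = ?I + ennreal (1 / real k) * (\<Sum>j<k. ?I)"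
    unfolding vil_dom_def
    by (simp add: nn_integral_add nn_integral_cmult nn_integral_sum meas borel_measurable_sum
        borel_measurable_times_ennreal nn_integral_vil_avg del: sum_constant)
  also have "\<dots> = ?I + ennreal (1 / real k) * ennreal (real k) * ?I"
    by (simp add: ennreal_of_nat_eq_real_of_nat mult.assoc)
  also have "ennreal (1 / real k) * ennreal (real k) = ennreal (1 / real k * real k)"
    by (rule ennreal_mult[symmetric]) auto
  \<comment> \<open>For \<open>k = 0\<close> the product is 0, as division by zero gives 0; hence an
    inequality.\<close>
  also have "\<dots> \<le> 1" by (simp add: ennreal_le_1)
  finally show ?thesis
    by (simp add: mult_2 add_left_mono mult_right_mono)
qed

lemma sum_vil_avg_vil_inc_le:
  assumes f: "vil_martingale m f" and x: "x \<in> vil_group m" and k: "k \<le> Suc N"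
  shows "(\<Sum>j\<le>N. vil_avg j (vil_inc f k) x) \<le> ennreal (real (Suc N)) * vil_dom f k x"
proof -
  let ?a = "\<lambda>j. vil_avg j (vil_inc f k) x"
  have a: "?a j = vil_inc f k x" if "k \<le> j" for j
    using that by (intro vil_avg_eq[OF x] vil_inc_cong[OF f _ x]) auto
  have "(\<Sum>j\<le>N. ?a j) \<le> (\<Sum>j<k. ?a j) + (\<Sum>j\<in>{k..N}. ?a j)"
  proof -
    have "(\<Sum>j\<le>N. ?a j) \<le> sum ?a ({..<k} \<union> {k..N})"
      by (intro sum_mono2) auto
    also have "\<dots> = (\<Sum>j<k. ?a j) + (\<Sum>j\<in>{k..N}. ?a j)"
      by (intro sum.union_disjoint) auto
    finally show ?thesis .
  qed
  also have "(\<Sum>j\<in>{k..N}. ?a j) = of_nat (Suc N - k) * vil_inc f k x"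
    using a by simp
  also have "\<dots> \<le> ennreal (real (Suc N)) * vil_inc f k x"
    by (intro mult_right_mono) (auto simp only: ennreal_of_nat_eq_real_of_nat intro!: ennreal_leI of_nat_mono zero_le)
  also have "(\<Sum>j<k. ?a j) \<le> ennreal (real (Suc N)) * (ennreal (1 / real k) * (\<Sum>j<k. ?a j))"
  proof (cases "k = 0")
    case False
    have "1 \<le> real (Suc N) * (1 / real k)" using False k by simp
    then have "1 \<le> ennreal (real (Suc N) * (1 / real k))" by simp
    also have "\<dots> = ennreal (real (Suc N)) * ennreal (1 / real k)"
      by (rule ennreal_mult) auto
    finally show ?thesis
      using mult_right_mono[of 1 "ennreal (real (Suc N)) * ennreal (1 / real k)" "\<Sum>j<k. ?a j"]
      by (simp add: mult.assoc)
  qed simp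
  finally show ?thesis
    by (simp add: vil_dom_def distrib_left add.commute add_mono)
qed

section \<open>Pointwise bounds and the maximal operator\<close>

lemma norm_vil_S_le_vil_avg:
  assumes g: "integrable (vil_measure m) g" and x: "x \<in> vil_group m"
    and n: "n < vil_M m (Suc N)" and B: "\<And>k. m k \<le> B"
  shows "ennreal (norm (vil_S m n g x)) \<le>
    ennreal (real B) * (\<Sum>j\<le>N. vil_avg j (\<lambda>t. ennreal (norm (g t))) x)"
proof -
  let ?K = "\<lambda>j t. ennreal (norm (vil_kernel (vil_M m j) x t))"
  let ?g = "\<lambda>t. ennreal (norm (g t))"
  note [measurable] = borel_measurable_integrable[OF g] measurable_norm_vil_kernel'[OF x]
  have meas: "(\<lambda>t. ?g t * ?K j t) \<in> borel_measurable (vil_measure m)" for j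
    by measurable
  have "ennreal (norm (vil_S m n g x)) \<le> (\<integral>\<^sup>+t. ennreal (norm (g t * vil_kernel n x t)) \<partial>vil_measure m)"
    unfolding vil_S_eq_kernel[OF g]
    by (rule integral_norm_bound_ennreal[OF integrable_mult_vil_kernel[OF g]])
  also have "\<dots> \<le> (\<integral>\<^sup>+t. ennreal (real B) * (\<Sum>j\<le>N. ?g t * ?K j t) \<partial>vil_measure m)"
  proof (rule nn_integral_mono)
    fix t
    have "norm (g t * vil_kernel n x t) \<le> norm (g t) * (real B * (\<Sum>j\<le>N. norm (vil_kernel (vil_M m j) x t)))"
      using norm_vil_kernel_le[OF n B, of x t] by (simp add: norm_mult mult_left_mono lessThan_Suc_atMost)
    also have "\<dots> = real B * (\<Sum>j\<le>N. norm (g t) * norm (vil_kernel (vil_M m j) x t))"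
      by (simp add: sum_distrib_left mult_ac)
    finally have "ennreal (norm (g t * vil_kernel n x t)) \<le>
        ennreal (real B * (\<Sum>j\<le>N. norm (g t) * norm (vil_kernel (vil_M m j) x t)))"
      by (rule ennreal_leI)
    also have "\<dots> = ennreal (real B) * (\<Sum>j\<le>N. ?g t * ?K j t)"
      by (simp add: ennreal_mult sum_nonneg sum_ennreal[symmetric])
    finally show "ennreal (norm (g t * vil_kernel n x t)) \<le> ennreal (real B) * (\<Sum>j\<le>N. ?g t * ?K j t)" .
  qed
  also have "\<dots> = ennreal (real B) * (\<integral>\<^sup>+t. (\<Sum>j\<le>N. ?g t * ?K j t) \<partial>vil_measure m)"
    by (rule nn_integral_cmult[OF borel_measurable_sum[OF meas]])
  also have "(\<integral>\<^sup>+t. (\<Sum>j\<le>N. ?g t * ?K j t) \<partial>vil_measure m) = (\<Sum>j\<le>N. vil_avg j ?g x)"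
    unfolding vil_avg_def by (rule nn_integral_sum[OF meas])
  finally show ?thesis .
qed

lemma vil_avg_mono: "(\<And>t. g t \<le> h t) \<Longrightarrow> vil_avg j g x \<le> vil_avg j h x"
  unfolding vil_avg_def by (intro nn_integral_mono mult_right_mono) auto

lemma vil_avg_sum:
  assumes x: "x \<in> vil_group m" and h: "\<And>k. h k \<in> borel_measurable (vil_measure m)"
  shows "vil_avg j (\<lambda>t. \<Sum>k\<in>A. h k t) x = (\<Sum>k\<in>A. vil_avg j (h k) x)"
  unfolding vil_avg_def sum_distrib_right
  by (intro nn_integral_sum borel_measurable_times_ennreal h measurable_norm_vil_kernel' x)

text \<open>\<open>f (Suc N)\<close> already carries all coefficients below \<open>n\<close>.
  Dominating it by increments and exchanging the sums collects the averages of each increment.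
  Extending to the full series leaves \<open>N\<close> only in the factor
  \<open>Suc N\<close>.\<close>

lemma norm_vil_mart_S_le:
  assumes f: "vil_martingale m f" and x: "x \<in> vil_group m"
    and n: "n < vil_M m (Suc N)" and B: "\<And>k. m k \<le> B"
  shows "ennreal (norm (vil_mart_S m n f x)) \<le>
    ennreal (real B * real (Suc N)) * (\<Sum>k. vil_dom f k x)"
proof -
  have int: "integrable (vil_measure m) (f (Suc N))"
    using f by (simp add: vil_martingale_def)
  have "ennreal (norm (vil_mart_S m n f x)) = ennreal (norm (vil_S m n (f (Suc N)) x))"
    using n by (simp add: vil_mart_S_eq[OF f, of n "Suc N"])
  also have "\<dots> \<le> ennreal (real B) * (\<Sum>j\<le>N. vil_avg j (\<lambda>t. ennreal (norm (f (Suc N) t))) x)"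
    by (rule norm_vil_S_le_vil_avg[OF int x n B])
  also have "\<dots> \<le> ennreal (real B) * (\<Sum>j\<le>N. vil_avg j (\<lambda>t. \<Sum>k\<le>Suc N. vil_inc f k t) x)"
    by (intro mult_left_mono sum_mono vil_avg_mono norm_le_sum_vil_inc) auto
  also have "(\<Sum>j\<le>N. vil_avg j (\<lambda>t. \<Sum>k\<le>Suc N. vil_inc f k t) x) =
      (\<Sum>j\<le>N. \<Sum>k\<le>Suc N. vil_avg j (vil_inc f k) x)"
    by (intro sum.cong refl vil_avg_sum x measurable_vil_inc f)
  also have "\<dots> = (\<Sum>k\<le>Suc N. \<Sum>j\<le>N. vil_avg j (vil_inc f k) x)"
    by (rule sum.swap)
  also have "\<dots> \<le> (\<Sum>k\<le>Suc N. ennreal (real (Suc N)) * vil_dom f k x)"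
    by (intro sum_mono sum_vil_avg_vil_inc_le f x) simp
  also have "\<dots> = ennreal (real (Suc N)) * (\<Sum>k\<le>Suc N. vil_dom f k x)"
    by (rule sum_distrib_left[symmetric])
  also have "(\<Sum>k\<le>Suc N. vil_dom f k x) \<le> (\<Sum>k. vil_dom f k x)"
    by (intro sum_le_suminf summableI) auto
  also have "ennreal (real B) * (ennreal (real (Suc N)) * (\<Sum>k. vil_dom f k x)) =
      ennreal (real B * real (Suc N)) * (\<Sum>k. vil_dom f k x)"
    by (simp only: ennreal_mult of_nat_0_le_iff mult.assoc)
  finally show ?thesis
    by (meson mult_left_mono zero_le)
qed

lemma obtain_vil_M_interval:
  assumes "n \<ge> 1"
  obtains N where "vil_M m N \<le> n" "n < vil_M m (Suc N)"
proof -
  define N where "N = (LEAST N. n < vil_M m (Suc N))"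
  have "n < vil_M m (Suc n)"
    using vil_M_gt[of m n, OF m_ge_2] vil_M_mono[of n "Suc n"] by linarith
  then have 1: "n < vil_M m (Suc N)"
    unfolding N_def by (rule LeastI)
  have "vil_M m N \<le> n"
  proof (cases N)
    case 0
    then show ?thesis using assms by simp
  next
    case (Suc N')
    then have "\<not> n < vil_M m (Suc N')"
      unfolding N_def by (intro not_less_Least) simp
    then show ?thesis using Suc by simp
  qed
  with 1 show thesis by (rule that[rotated])
qed

text \<open>Both \<open>real N * ln 2\<close> and \<open>ln 2\<close> are at most the logarithm on
  the right; adding the two bounds produces the factor one half.\<close>

lemma ln_ge_index:
  assumes "vil_M m N \<le> n" "n \<ge> 1"
  shows "real (Suc N) * (ln 2 / 2) \<le> ln (real (n + 1))"
proof -
  have "2 ^ N \<le> n" using power_le_vil_M[of N] assms(1) by linarith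
  then have "2 ^ N \<le> n + 1" by simp
  then have "real (2 ^ N) \<le> real (n + 1)" by (rule of_nat_mono)
  then have "(2::real) ^ N \<le> real (n + 1)" by (simp only: of_nat_power of_nat_numeral)
  then have "ln (2 ^ N) \<le> ln (real (n + 1))" by (subst ln_le_cancel_iff) auto
  then have "real N * ln 2 \<le> ln (real (n + 1))" by (simp add: ln_realpow)
  moreover have "ln 2 \<le> ln (real (n + 1))" using assms(2) by (subst ln_le_cancel_iff) auto
  ultimately have "real N * ln 2 + ln 2 \<le> ln (real (n + 1)) + ln (real (n + 1))"
    by (rule add_mono)
  then show ?thesis by (simp add: field_simps)
qed

text \<open>The logarithm absorbs the factor \<open>Suc N\<close> of
  \<open>norm_vil_mart_S_le\<close>, which leaves one majorant common to all
  \<open>n\<close>.\<close>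

lemma vil_S_max_le:
  assumes f: "vil_martingale m f" and x: "x \<in> vil_group m" and B: "\<And>k. m k \<le> B"
  shows "vil_S_max m f x \<le> ennreal (2 * real B / ln 2) * (\<Sum>k. vil_dom f k x)"
  unfolding vil_S_max_def
proof (rule SUP_least)
  fix n :: nat assume "n \<in> {1..}"
  then have n1: "n \<ge> 1" by simp
  obtain N where N: "vil_M m N \<le> n" "n < vil_M m (Suc N)"
    using obtain_vil_M_interval[OF n1] .
  let ?l = "ln (real (n + 1))"
  have l: "?l > 0" using n1 by simp
  have "ennreal (norm (vil_mart_S m n f x) / ?l) = ennreal (1 / ?l) * ennreal (norm (vil_mart_S m n f x))"
    using l by (simp add: ennreal_mult[symmetric])
  also have "\<dots> \<le> ennreal (1 / ?l) * (ennreal (real B * real (Suc N)) * (\<Sum>k. vil_dom f k x))"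
    by (intro mult_left_mono norm_vil_mart_S_le[OF f x N(2) B]) auto
  also have "\<dots> = ennreal (1 / ?l * (real B * real (Suc N))) * (\<Sum>k. vil_dom f k x)"
    using l by (subst ennreal_mult) (auto simp: mult.assoc)
  also have "\<dots> \<le> ennreal (2 * real B / ln 2) * (\<Sum>k. vil_dom f k x)"
  proof (intro mult_right_mono ennreal_leI)
    have "real B * (real (Suc N) * (ln 2 / 2)) \<le> real B * ?l"
      by (intro mult_left_mono ln_ge_index N n1) simp
    then show "1 / ?l * (real B * real (Suc N)) \<le> 2 * real B / ln 2"
      using l by (simp add: field_simps)
  qed auto
  finally show "ennreal (norm (vil_mart_S m n f x) / ?l) \<le> \<dots>" .
qed

text \<open>The majorant is integrated termwise: each \<open>vil_dom f k\<close> costs at most twice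
  its increment, and the increments resum to at most the maximal function.\<close>

theorem bounded_vil_S_max:
  assumes B: "\<And>k. m k \<le> B"
  shows "bounded_H1_L1 m (vil_S_max m)"
  unfolding bounded_H1_L1_def
proof (intro exI conjI ballI)
  let ?c = "2 * real B / ln 2"
  show "0 \<le> ?c * 2" by simp
  fix f assume "f \<in> vil_H1 m"
  then have f: "vil_martingale m f" by (simp add: vil_H1_def)
  have "vil_L1_norm m (vil_S_max m f) \<le> (\<integral>\<^sup>+x. ennreal ?c * (\<Sum>k. vil_dom f k x) \<partial>vil_measure m)"
    unfolding vil_L1_norm_def
    by (intro nn_integral_mono vil_S_max_le[OF f _ B]) (simp add: space_vil_measure)
  also have "\<dots> = ennreal ?c * (\<integral>\<^sup>+x. (\<Sum>k. vil_dom f k x) \<partial>vil_measure m)"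
    by (intro nn_integral_cmult borel_measurable_suminf_order measurable_vil_dom[OF f])
  also have "(\<integral>\<^sup>+x. (\<Sum>k. vil_dom f k x) \<partial>vil_measure m) = (\<Sum>k. \<integral>\<^sup>+x. vil_dom f k x \<partial>vil_measure m)"
    by (rule nn_integral_suminf[OF measurable_vil_dom[OF f]])
  also have "\<dots> \<le> (\<Sum>k. 2 * (\<integral>\<^sup>+x. vil_inc f k x \<partial>vil_measure m))"
    by (intro suminf_le nn_integral_vil_dom_le[OF f] summableI)
  also have "\<dots> = 2 * (\<Sum>k. \<integral>\<^sup>+x. vil_inc f k x \<partial>vil_measure m)"
    by (rule ennreal_suminf_cmult)
  also have "(\<Sum>k. \<integral>\<^sup>+x. vil_inc f k x \<partial>vil_measure m) = (\<integral>\<^sup>+x. (\<Sum>k. vil_inc f k x) \<partial>vil_measure m)"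
    by (rule nn_integral_suminf[OF measurable_vil_inc[OF f], symmetric])
  also have "\<dots> \<le> vil_H1_norm m f"
    unfolding vil_H1_norm_def vil_L1_norm_def by (intro nn_integral_mono suminf_vil_inc_le)
  also have "ennreal ?c * (2 * vil_H1_norm m f) = ennreal (?c * 2) * vil_H1_norm m f"
    by (subst ennreal_mult) (auto simp: mult.assoc)
  finally show "vil_L1_norm m (vil_S_max m f) \<le> ennreal (?c * 2) * vil_H1_norm m f"
    by (meson mult_left_mono zero_le order_trans)
qed

end

subsection \<open>Sharpness of the logarithm\<close>

lemma vil_q_Suc: "vil_q m (Suc n) = vil_M m (2 * Suc n) + vil_q m n"
  by (simp add: vil_q_def)

context vilenkin
begin

section \<open>Dirichlet kernels at the identity\<close>

lemma zero_in_vil_group: "(\<lambda>_. 0) \<in> vil_group m"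
  by (simp add: vil_group_def)

lemma vil_D_eq_kernel: "vil_D m n x = vil_kernel n x (\<lambda>_. 0)"
proof -
  have "vil_psi m k (\<lambda>_. 0) = 1" for k
    by (simp add: vil_psi_def vil_r_def)
  then show ?thesis by (simp add: vil_D_def vil_kernel_def)
qed

lemma norm_vil_D_M:
  assumes "x \<in> vil_group m"
  shows "norm (vil_D m (vil_M m N) x) = (if \<forall>i<N. x i = 0 then real (vil_M m N) else 0)"
  unfolding vil_D_eq_kernel vil_kernel_M[OF assms zero_in_vil_group]
  by (simp only: if_distrib[of norm] norm_of_nat norm_zero)

lemma norm_vil_D_le: "norm (vil_D m n x) \<le> real n"
proof -
  have "norm (vil_D m n x) \<le> (\<Sum>k<n. 1)"
    unfolding vil_D_def by (rule sum_norm_le) simp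
  then show ?thesis by simp
qed

lemma integrable_vil_psi: "integrable (vil_measure m) (vil_psi m k)"
  using integrable_vil_psi_cnj[of k 0] by simp

lemma integrable_vil_D: "integrable (vil_measure m) (vil_D m n)"
proof -
  have "integrable (vil_measure m) (\<lambda>x. \<Sum>k<n. vil_psi m k x)"
    by (intro Bochner_Integration.integrable_sum integrable_vil_psi)
  then show ?thesis by (simp add: vil_D_def[abs_def])
qed

lemma nn_integral_norm_vil_D_M:
  "(\<integral>\<^sup>+x. ennreal (norm (vil_D m (vil_M m N) x)) \<partial>vil_measure m) = 1"
  unfolding vil_D_eq_kernel by (rule nn_integral_norm_vil_kernel_M[OF zero_in_vil_group])

lemma LINT_norm_vil_D_M: "(LINT x|vil_measure m. norm (vil_D m (vil_M m N) x)) = 1"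
  using nn_integral_norm_vil_D_M[of N]
  by (simp add: nn_integral_eq_integral[OF integrable_norm[OF integrable_vil_D]])

text \<open>The indices from \<open>vil_M m N\<close> on have leading digit 1 at place
  \<open>N\<close>, a legal digit as \<open>m N \<ge> 2\<close>.\<close>

lemma vil_D_M_add:
  assumes "d \<le> vil_M m N"
  shows "vil_D m (vil_M m N + d) x = vil_D m (vil_M m N) x + vil_r m N x * vil_D m d x"
proof -
  have "vil_psi m (vil_M m N + k) x = vil_r m N x * vil_psi m k x" if "k < d" for k
    using vil_psi_split[of 1 N k x] that assms m_ge_2[of N] by simp
  then show ?thesis
    by (simp add: vil_D_def sum_lessThan_add sum_distrib_left)
qed

section \<open>Lower bound for the kernels of index \<open>vil_q m n\<close>\<close>

text \<open>Two levels multiply \<open>vil_M m\<close> by at least 4. With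
  \<open>M = vil_M m (2 * Suc n)\<close> the induction step reads
  \<open>3 * M + 3 * vil_q m n \<le> 4 * M\<close>.\<close>

lemma vil_q_le: "3 * vil_q m n \<le> vil_M m (2 * Suc n)"
proof (induction n)
  have M: "4 * vil_M m k \<le> vil_M m (Suc (Suc k))" for k
  proof -
    have "(2 * 2) * vil_M m k \<le> (m (Suc k) * m k) * vil_M m k"
      by (intro mult_right_mono mult_mono m_ge_2) auto
    then show ?thesis by (simp add: mult.assoc)
  qed
  case 0
  show ?case using M[of 0] by (simp add: vil_q_def numeral_2_eq_2)
  case (Suc n)
  show ?case using M[of "2 * Suc n"] Suc by (simp add: vil_q_Suc del: vil_M_Suc)
qed

text \<open>Ensures that \<open>vil_q m n\<close> stays inside the frequency block of
  \<open>vil_fk m n\<close>.\<close>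

lemma vil_q_le_M: "vil_q m n \<le> vil_M m (2 * n + 1)"
proof (cases n)
  case 0
  then show ?thesis by (simp add: vil_q_def)
next
  case (Suc k)
  have "2 * vil_M m (2 * n) \<le> vil_M m (2 * n + 1)"
    using m_ge_2[of "2 * n"] by simp
  then show ?thesis using vil_q_le[of k] unfolding Suc vil_q_Suc by linarith
qed

lemma vil_q_gt: "n < vil_q m n"
  using vil_M_gt[of m "2 * n", OF m_ge_2]
  by (cases n) (auto simp: vil_q_Suc vil_q_def simp del: vil_M_Suc)

text \<open>The \<open>j\<close>-th summand equals \<open>vil_M m (2 * j)\<close> on \<open>vil_I m (2 * j) 0 - vil_I m (2 * j + 1) 0\<close>
  and vanishes elsewhere.\<close>

lemma norm_vil_D_q_ge:
  assumes x: "x \<in> vil_group m"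
  shows "2 / 3 * (\<Sum>j\<le>n. norm (vil_D m (vil_M m (2 * j)) x)
      - norm (vil_D m (vil_M m (2 * j + 1)) x) / real (m (2 * j))) \<le> norm (vil_D m (vil_q m n) x)"
    (is "2 / 3 * (\<Sum>j\<le>n. ?e j) \<le> _")
proof (induction n)
  case 0
  have D0: "norm (vil_D m (vil_M m (2 * 0)) x) = 1" by (simp add: vil_D_def)
  have D1: "0 \<le> norm (vil_D m (vil_M m (2 * 0 + 1)) x) / real (m (2 * 0))" by simp
  have q: "norm (vil_D m (vil_q m 0) x) = 1" by (simp add: vil_q_def vil_D_def)
  have "2 / 3 * (\<Sum>j\<le>0. ?e j) = 2 / 3 * ?e 0" by simp
  also have "\<dots> \<le> 2 / 3 * 1"
    unfolding D0 by (intro mult_left_mono) (use D1 in simp_all)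
  finally show ?case unfolding q by simp
next
  case (Suc n)
  let ?M = "vil_M m (2 * Suc n)"
  have q: "vil_q m n \<le> ?M" "3 * vil_q m n \<le> ?M" using vil_q_le[of n] by linarith+
  have D: "vil_D m (vil_q m (Suc n)) x = vil_D m ?M x + vil_r m (2 * Suc n) x * vil_D m (vil_q m n) x"
    unfolding vil_q_Suc by (rule vil_D_M_add[OF q(1)])
  show ?case
  proof (cases "\<forall>i<2 * Suc n. x i = 0")
    case True
    \<comment> \<open>At an earlier level both kernels are nonzero at \<open>x\<close>, and they
      cancel because \<open>vil_M m (2 * j + 1)\<close> is \<open>m (2 * j)\<close> times
      \<open>vil_M m (2 * j)\<close>.\<close>
    have e: "?e j = 0" if "j \<le> n" for j
    proof -
      have "\<forall>i<2 * j. x i = 0" "\<forall>i<2 * j + 1. x i = 0" using True that by auto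
      then show ?thesis using x by (simp add: norm_vil_D_M del: vil_M_Suc) simp
    qed
    have DM: "norm (vil_D m ?M x) = real ?M" unfolding norm_vil_D_M[OF x] using True by (rule if_P)
    have "2 / 3 * (\<Sum>j\<le>Suc n. ?e j) = 2 / 3 * ?e (Suc n)" using e by simp
    also have "\<dots> \<le> 2 / 3 * real ?M" unfolding DM by simp
    \<comment> \<open>The source of the constant 2/3: the lower terms amount to at most a third of
      \<open>?M\<close>.\<close>
    also have "\<dots> \<le> real ?M - real (vil_q m n)" using q(2) by linarith
    also have "\<dots> \<le> norm (vil_D m ?M x) - norm (vil_r m (2 * Suc n) x * vil_D m (vil_q m n) x)"
      unfolding DM using norm_vil_D_le[of "vil_q m n" x] by (simp add: norm_mult)
    also have "\<dots> \<le> norm (vil_D m (vil_q m (Suc n)) x)"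
      unfolding D by (rule norm_diff_ineq)
    finally show ?thesis .
  next
    case False
    \<comment> \<open>Both new kernels vanish at \<open>x\<close>; only a unimodular factor is
      added, so the bound is inherited.\<close>
    then have "norm (vil_D m ?M x) = 0" by (simp only: norm_vil_D_M[OF x] if_False)
    moreover have "norm (vil_D m (vil_M m (2 * Suc n + 1)) x) = 0"
    proof -
      have "\<not> (\<forall>i<2 * Suc n + 1. x i = 0)"
        using False by (meson trans_less_add1)
      then show ?thesis by (simp only: norm_vil_D_M[OF x] if_False)
    qed
    ultimately show ?thesis using Suc.IH unfolding D by (simp add: norm_mult)
  qed
qed

text \<open>Each kernel of index \<open>vil_M m j\<close> has norm one, so the \<open>j\<close>-th
  summand has integral \<open>1 - 1 / m (2 * j) \<ge> 1 / 2\<close>, and 2/3 times 1/2 is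
  1/3.\<close>

lemma LINT_norm_vil_D_q_ge: "real (Suc n) / 3 \<le> (LINT x|vil_measure m. norm (vil_D m (vil_q m n) x))"
proof -
  note int = integrable_norm[OF integrable_vil_D]
  have "real (Suc n) / 3 = (\<Sum>j\<le>n. 2 / 3 * (1 / 2))" by simp
  also have "\<dots> \<le> (\<Sum>j\<le>n. 2 / 3 * (1 - 1 / real (m (2 * j))))"
  proof (intro sum_mono mult_left_mono)
    fix j
    have "real (m (2 * j)) \<ge> 2" using m_ge_2[of "2 * j"] by simp
    then show "1 / 2 \<le> 1 - 1 / real (m (2 * j))" by (simp add: field_simps)
  qed simp
  also have "\<dots> = (LINT x|vil_measure m. 2 / 3 * (\<Sum>j\<le>n. norm (vil_D m (vil_M m (2 * j)) x)
      - norm (vil_D m (vil_M m (2 * j + 1)) x) / real (m (2 * j))))"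
    by (simp add: int LINT_norm_vil_D_M sum_distrib_left del: vil_M_Suc)
  also have "\<dots> \<le> (LINT x|vil_measure m. norm (vil_D m (vil_q m n) x))"
  proof (rule integral_mono[OF _ int])
    show "integrable (vil_measure m) (\<lambda>x. 2 / 3 * (\<Sum>j\<le>n. norm (vil_D m (vil_M m (2 * j)) x)
        - norm (vil_D m (vil_M m (2 * j + 1)) x) / real (m (2 * j))))"
      by (rule integrable_mult_right, rule Bochner_Integration.integrable_sum,
          rule Bochner_Integration.integrable_diff[OF int integrable_divide[OF int]])
  qed (simp only: space_vil_measure norm_vil_D_q_ge)
  finally show ?thesis .
qed

section \<open>The functions \<open>vil_fk m n\<close> and their norms\<close>

text \<open>The factor \<open>1\<close> makes the sum an instance of
  \<open>vil_coeff_sum\<close>.\<close>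

lemma vil_fk_eq_sum: "vil_fk m n x = (\<Sum>k\<in>{vil_M m (2 * n)..<vil_M m (2 * n + 1)}. 1 * vil_psi m k x)"
proof -
  have "vil_M m (2 * n) \<le> vil_M m (2 * n + 1)" by (rule vil_M_mono) simp
  then have "vil_fk m n x = (\<Sum>k\<in>{..<vil_M m (2 * n + 1)} - {..<vil_M m (2 * n)}. vil_psi m k x)"
    unfolding vil_fk_def vil_D_def by (intro sum_diff[symmetric]) (simp_all only: finite_lessThan lessThan_subset_iff)
  also have "{..<vil_M m (2 * n + 1)} - {..<vil_M m (2 * n)} = {vil_M m (2 * n)..<vil_M m (2 * n + 1)}"
    by auto
  finally show ?thesis by (simp only: mult_1_left)
qed

lemma integrable_vil_fk: "integrable (vil_measure m) (vil_fk m n)"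
  unfolding vil_fk_def[abs_def] by (intro Bochner_Integration.integrable_diff integrable_vil_D)

lemma vil_coeff_vil_fk:
  "vil_coeff m (vil_fk m n) k = (if k \<in> {vil_M m (2 * n)..<vil_M m (2 * n + 1)} then 1 else 0)"
  unfolding vil_fk_eq_sum[abs_def] by (rule vil_coeff_sum) simp

lemma vil_S_vil_fk:
  "vil_S m N (vil_fk m n) x =
    (\<Sum>k\<in>{..<N} \<inter> {vil_M m (2 * n)..<vil_M m (2 * n + 1)}. vil_psi m k x)"
proof -
  have "vil_S m N (vil_fk m n) x =
      (\<Sum>k<N. if k \<in> {vil_M m (2 * n)..<vil_M m (2 * n + 1)} then vil_psi m k x else 0)"
    unfolding vil_S_def vil_coeff_vil_fk by (intro sum.cong) auto
  also have "\<dots> = (\<Sum>k\<in>{..<N} \<inter> {vil_M m (2 * n)..<vil_M m (2 * n + 1)}. vil_psi m k x)"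
    by (rule sum.inter_restrict[symmetric]) simp
  finally show ?thesis .
qed

text \<open>The partial sum cuts the block after its first \<open>vil_q m n\<close> characters,
  leaving a difference of Dirichlet kernels that \<open>vil_D_M_add\<close> evaluates.\<close>

lemma norm_vil_S_q_vil_fk:
  "norm (vil_S m (vil_q m (Suc n)) (vil_fk m (Suc n)) x) = norm (vil_D m (vil_q m n) x)"
proof -
  let ?M = "vil_M m (2 * Suc n)"
  have q: "vil_q m n \<le> ?M" using vil_q_le[of n] by linarith
  have set: "{..<vil_q m (Suc n)} \<inter> {?M..<vil_M m (2 * Suc n + 1)} = {..<?M + vil_q m n} - {..<?M}"
    using vil_q_le_M[of "Suc n"] unfolding vil_q_Suc by auto
  have "vil_S m (vil_q m (Suc n)) (vil_fk m (Suc n)) x =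
      vil_D m (?M + vil_q m n) x - vil_D m ?M x"
    unfolding vil_S_vil_fk vil_D_def set by (rule sum_diff) auto
  also have "\<dots> = vil_r m (2 * Suc n) x * vil_D m (vil_q m n) x"
    by (simp only: vil_D_M_add[OF q] add_diff_cancel_left')
  finally show ?thesis by (simp add: norm_mult)
qed

text \<open>The whole frequency block lies between two consecutive levels, so the martingale jumps
  once, from 0 to \<open>vil_fk m n\<close> at level \<open>2 * n + 1\<close>.\<close>

lemma vil_max_vil_fk: "vil_max (vil_mart_of m (vil_fk m n)) x = ennreal (norm (vil_fk m n x))"
  unfolding vil_max_def
proof (rule antisym)
  have S: "vil_mart_of m (vil_fk m n) N x = (if N \<le> 2 * n then 0 else vil_fk m n x)" for N
  proof (cases "N \<le> 2 * n")
    case True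
    then have "{..<vil_M m N} \<inter> {vil_M m (2 * n)..<vil_M m (2 * n + 1)} = {}"
      using vil_M_mono[OF True] by auto
    then show ?thesis using True by (simp add: vil_mart_of_def vil_S_vil_fk del: vil_M_Suc)
  next
    case False
    then have "{..<vil_M m N} \<inter> {vil_M m (2 * n)..<vil_M m (2 * n + 1)} =
        {vil_M m (2 * n)..<vil_M m (2 * n + 1)}"
      using vil_M_mono[of "2 * n + 1" N] by auto
    then show ?thesis
      using False unfolding vil_mart_of_def vil_S_vil_fk vil_fk_eq_sum by simp
  qed
  show "(SUP N. ennreal (norm (vil_mart_of m (vil_fk m n) N x))) \<le> ennreal (norm (vil_fk m n x))"
    by (rule SUP_least) (simp add: S)
  show "ennreal (norm (vil_fk m n x)) \<le> (SUP N. ennreal (norm (vil_mart_of m (vil_fk m n) N x)))"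
    by (rule SUP_upper2[of "2 * n + 1"]) (simp_all add: S)
qed

text \<open>From below the norm dominates a coefficient equal to 1; from above it is at most the sum
  of the norms of two kernels of norm one.\<close>

lemma vil_H1_norm_vil_fk:
  "1 \<le> vil_H1_norm m (vil_mart_of m (vil_fk m n))" (is "1 \<le> ?H")
  "vil_H1_norm m (vil_mart_of m (vil_fk m n)) \<le> 2"
proof -
  have H: "?H = (\<integral>\<^sup>+x. ennreal (norm (vil_fk m n x)) \<partial>vil_measure m)"
    by (simp add: vil_H1_norm_def vil_L1_norm_def vil_max_vil_fk)
  let ?M = "vil_M m (2 * n)"
  have "vil_coeff m (vil_fk m n) ?M = 1"
    using strict_monoD[OF vil_M_strict_mono, of "2 * n" "2 * n + 1"]
    by (simp add: vil_coeff_vil_fk del: vil_M_Suc)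
  then have "1 = ennreal (norm (LINT x|vil_measure m. vil_fk m n x * cnj (vil_psi m ?M x)))"
    by (simp add: vil_coeff_def)
  also have "\<dots> \<le> (\<integral>\<^sup>+x. ennreal (norm (vil_fk m n x * cnj (vil_psi m ?M x))) \<partial>vil_measure m)"
    by (rule integral_norm_bound_ennreal[OF integrable_mult_cnj_vil_psi[OF integrable_vil_fk]])
  finally show "1 \<le> ?H" by (simp add: H norm_mult)
  note [measurable] = borel_measurable_integrable[OF integrable_vil_D]
  have "?H \<le> (\<integral>\<^sup>+x. ennreal (norm (vil_D m (vil_M m (2 * n + 1)) x))
      + ennreal (norm (vil_D m ?M x)) \<partial>vil_measure m)"
    unfolding H vil_fk_def
    by (intro nn_integral_mono) (simp add: norm_triangle_ineq4 del: vil_M_Suc flip: ennreal_plus)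
  also have "\<dots> = 1 + 1"
    by (subst nn_integral_add) (simp_all add: nn_integral_norm_vil_D_M del: vil_M_Suc)
  finally show "?H \<le> 2" by simp
qed

section \<open>Divergence of the norm ratios\<close>

text \<open>The 6 combines the 3 of \<open>LINT_norm_vil_D_q_ge\<close> with the bound 2 on the norm
  in the denominator. Both norms are finite, so \<open>enn2real\<close> keeps their values.\<close>

lemma ratio_ge:
  assumes "c > 0"
  shows "real (Suc k) / (6 * c) \<le>
    enn2real (vil_L1_norm m (\<lambda>x. ennreal (norm
      (vil_S m (vil_q m (Suc k)) (vil_fk m (Suc k)) x / of_real c)))) /
    enn2real (vil_H1_norm m (vil_mart_of m (vil_fk m (Suc k))))"
proof -
  let ?H = "enn2real (vil_H1_norm m (vil_mart_of m (vil_fk m (Suc k))))"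
  have fin: "vil_H1_norm m (vil_mart_of m (vil_fk m (Suc k))) < \<infinity>"
    using vil_H1_norm_vil_fk(2)[of "Suc k"] by (rule le_less_trans) simp
  then have H: "1 \<le> ?H" "?H \<le> 2"
    using enn2real_mono[OF vil_H1_norm_vil_fk(1)[of "Suc k"]]
      enn2real_mono[OF vil_H1_norm_vil_fk(2)[of "Suc k"]] by simp_all
  have eq: "norm (vil_S m (vil_q m (Suc k)) (vil_fk m (Suc k)) x / of_real c) =
      norm (vil_D m (vil_q m k) x) / c" for x
    using assms by (simp add: norm_divide norm_vil_S_q_vil_fk)
  have "vil_L1_norm m (\<lambda>x. ennreal (norm
      (vil_S m (vil_q m (Suc k)) (vil_fk m (Suc k)) x / of_real c))) =
      ennreal (LINT x|vil_measure m. norm (vil_D m (vil_q m k) x) / c)"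
    unfolding vil_L1_norm_def eq using assms
    by (intro nn_integral_eq_integral integrable_divide integrable_norm integrable_vil_D) auto
  also have "\<dots> = ennreal ((LINT x|vil_measure m. norm (vil_D m (vil_q m k) x)) / c)"
    by simp
  finally have L: "enn2real (vil_L1_norm m (\<lambda>x. ennreal (norm
      (vil_S m (vil_q m (Suc k)) (vil_fk m (Suc k)) x / of_real c)))) =
      (LINT x|vil_measure m. norm (vil_D m (vil_q m k) x)) / c"
    using assms by simp
  have "real (Suc k) / (6 * c) = (real (Suc k) / 3 / c) / 2" by simp
  also have "\<dots> \<le> (real (Suc k) / 3 / c) / ?H"
    using H assms by (intro divide_left_mono) auto
  also have "\<dots> \<le> ((LINT x|vil_measure m. norm (vil_D m (vil_q m k) x)) / c) / ?H"
    using H assms by (intro divide_right_mono LINT_norm_vil_D_q_ge) auto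
  finally show ?thesis unfolding L .
qed

text \<open>The exponent \<open>2 * Suc (Suc k) + 1\<close> is at most \<open>5 * Suc k\<close>;
  this form matches the numerator of \<open>ratio_ge\<close>.\<close>

lemma ln_vil_q_le:
  assumes B: "\<And>k. m k \<le> B"
  shows "ln (real (vil_q m (Suc (Suc k)))) \<le> 5 * real (Suc k) * ln (real B)"
proof -
  have B2: "2 \<le> B" using m_ge_2[of 0] B[of 0] by linarith
  have "vil_M m n \<le> B ^ n" for n
    by (induction n) (auto intro!: mult_mono B)
  then have "vil_q m (Suc (Suc k)) \<le> B ^ (2 * Suc (Suc k) + 1)"
    using vil_q_le_M[of "Suc (Suc k)"] le_trans by blast
  also have "\<dots> \<le> B ^ (5 * Suc k)" using B2 by (intro power_increasing) auto
  finally have "real (vil_q m (Suc (Suc k))) \<le> real (B ^ (5 * Suc k))" by (rule of_nat_mono)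
  then have "ln (real (vil_q m (Suc (Suc k)))) \<le> ln (real (B ^ (5 * Suc k)))"
    using vil_q_gt[of "Suc (Suc k)"] B2 by (subst ln_le_cancel_iff) auto
  also have "\<dots> = 5 * real (Suc k) * ln (real B)"
    using B2 by (simp only: of_nat_power) (simp add: ln_realpow)
  finally show ?thesis .
qed

text \<open>The limsup gives arguments \<open>N\<close> with large ratio that need not have the form
  \<open>vil_q m k + 1\<close>. Locating \<open>N\<close> between two consecutive values of
  \<open>vil_q m\<close> suffices, since \<Phi> is monotone and the logarithm of the next value is
  still linear in \<open>k\<close>.\<close>

theorem SUP_ratio_eq_infinity:
  fixes \<Phi> :: "nat \<Rightarrow> real"
  assumes B: "\<And>k. m k \<le> B" and mono: "mono \<Phi>" and pos: "\<And>n. \<Phi> n > 0"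
    and limsup: "limsup (\<lambda>n. ereal (ln (real n) / \<Phi> n)) = \<infinity>"
  shows "(SUP k. ereal (
      enn2real (vil_L1_norm m (\<lambda>x. ennreal (norm
        (vil_S m (vil_q m (Suc k)) (vil_fk m (Suc k)) x / of_real (\<Phi> (vil_q m (Suc k) + 1))))))
      / enn2real (vil_H1_norm m (vil_mart_of m (vil_fk m (Suc k)))))) = \<infinity>"
proof (rule SUP_PInfty)
  fix R :: nat
  have B2: "2 \<le> B" using m_ge_2[of 0] B[of 0] by linarith
  then have lnB: "0 < ln (real B)" by simp
  \<comment> \<open>30 is the product of the 5 in \<open>ln_vil_q_le\<close> and the 6 in
    \<open>ratio_ge\<close>.\<close>
  let ?R = "30 * ln (real B) * real R"
  \<comment> \<open>The threshold settles the case \<open>k = 0\<close> of \<open>k2\<close>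
    below.\<close>
  have "\<exists>N\<ge>vil_q m 1 + 1. ?R < ln (real N) / \<Phi> N"
  proof (rule ccontr)
    assume "\<not> ?thesis"
    then have "eventually (\<lambda>n. ereal (ln (real n) / \<Phi> n) \<le> ereal ?R) sequentially"
      by (intro eventually_sequentiallyI[of "vil_q m 1 + 1"]) (simp add: not_less)
    then have "limsup (\<lambda>n. ereal (ln (real n) / \<Phi> n)) \<le> ereal ?R"
      by (rule Limsup_bounded)
    then show False using limsup by simp
  qed
  then obtain N where N: "vil_q m 1 + 1 \<le> N" "?R < ln (real N) / \<Phi> N" by blast
  define k where "k = (LEAST k. N \<le> vil_q m (Suc (Suc k)))"
  have "N \<le> vil_q m (Suc (Suc N))" using vil_q_gt[of "Suc (Suc N)"] by linarith
  then have k1: "N \<le> vil_q m (Suc (Suc k))" unfolding k_def by (rule LeastI)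
  have k2: "vil_q m (Suc k) + 1 \<le> N"
  proof (cases k)
    case 0
    then show ?thesis using N by simp
  next
    case (Suc k')
    then have "\<not> N \<le> vil_q m (Suc (Suc k'))" unfolding k_def by (intro not_less_Least) simp
    then show ?thesis using Suc by simp
  qed
  let ?c = "\<Phi> (vil_q m (Suc k) + 1)"
  have "?R < ln (real N) / \<Phi> N" by (rule N)
  also have "\<dots> \<le> ln (real N) / ?c"
    using k2 pos by (intro divide_left_mono monoD[OF mono] mult_pos_pos) auto
  also have "\<dots> \<le> 5 * real (Suc k) * ln (real B) / ?c"
  proof (rule divide_right_mono)
    have "ln (real N) \<le> ln (real (vil_q m (Suc (Suc k))))"
      using k1 k2 by (subst ln_le_cancel_iff) auto
    also note ln_vil_q_le[OF B]
    finally show "ln (real N) \<le> 5 * real (Suc k) * ln (real B)" .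
  qed (use pos[of "vil_q m (Suc k) + 1"] in simp)
  also have "\<dots> = (30 * ln (real B)) * (real (Suc k) / (6 * ?c))" by simp
  finally have "real R < real (Suc k) / (6 * ?c)"
    by (rule mult_less_cancel_left_pos[THEN iffD1, rotated]) (use lnB in simp)
  also note ratio_ge[OF pos]
  finally show "\<exists>k\<in>UNIV. ereal (real R) \<le> ereal (
      enn2real (vil_L1_norm m (\<lambda>x. ennreal (norm
        (vil_S m (vil_q m (Suc k)) (vil_fk m (Suc k)) x / of_real (\<Phi> (vil_q m (Suc k) + 1))))))
      / enn2real (vil_H1_norm m (vil_mart_of m (vil_fk m (Suc k)))))"
    by (intro bexI[of _ k]) (auto intro: less_imp_le)
qed

end

theorem theorem2p8:
  fixes m :: "nat \<Rightarrow> nat"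
  assumes m_ge_2: "\<forall>k. m k \<ge> 2"
    and m_bounded: "\<exists>B. \<forall>k. m k \<le> B"
  shows "bounded_H1_L1 m (vil_S_max m) \<and>
    (\<forall>\<Phi> :: nat \<Rightarrow> real.
      mono \<Phi> \<and> (\<forall>n. \<Phi> n > 0) \<and>
      limsup (\<lambda>n. ereal (ln (real n) / \<Phi> n)) = \<infinity> \<longrightarrow>
      (\<exists>\<nu> :: nat \<Rightarrow> nat. (\<forall>k. \<nu> k > 0) \<and>
        (SUP k. ereal (
            enn2real (vil_L1_norm m (\<lambda>x. ennreal (norm
              (vil_S m (vil_q m (\<nu> k)) (vil_fk m (\<nu> k)) x / of_real (\<Phi> (vil_q m (\<nu> k) + 1))))))
          / enn2real (vil_H1_norm m (vil_mart_of m (vil_fk m (\<nu> k)))))) = \<infinity>))"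
proof -
  interpret vilenkin m
    by unfold_locales (use m_ge_2 in blast)
  obtain B where B: "\<And>k. m k \<le> B"
    using m_bounded by blast
  show ?thesis
  proof (intro conjI allI impI)
    show "bounded_H1_L1 m (vil_S_max m)"
      by (rule bounded_vil_S_max[OF B])
    fix \<Phi> :: "nat \<Rightarrow> real"
    assume \<Phi>: "mono \<Phi> \<and> (\<forall>n. \<Phi> n > 0) \<and> limsup (\<lambda>n. ereal (ln (real n) / \<Phi> n)) = \<infinity>"
    show "\<exists>\<nu> :: nat \<Rightarrow> nat. (\<forall>k. \<nu> k > 0) \<and>
        (SUP k. ereal (
            enn2real (vil_L1_norm m (\<lambda>x. ennreal (norm
              (vil_S m (vil_q m (\<nu> k)) (vil_fk m (\<nu> k)) x / of_real (\<Phi> (vil_q m (\<nu> k) + 1))))))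
          / enn2real (vil_H1_norm m (vil_mart_of m (vil_fk m (\<nu> k)))))) = \<infinity>"
    proof (intro exI conjI)
      \<comment> \<open>This instantiates the sequence to \<open>Suc\<close>: all positive integers
        serve at once.\<close>
      show "\<forall>k. Suc k > 0" by simp
    qed (rule SUP_ratio_eq_infinity[OF B]; use \<Phi> in blast)
  qed
qed

end
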